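(* Let $p\in(0,1)$ and $$\theta=\frac{d(1-p)}{(1+p)\,(d(1-p)+2p)} .$$ There is a constant $C_p$ (depending only on $p$ and $d$) such that for all functions $f\in C^\infty(\mathbb{R}^d_+)$, $$\|f\|_{p+1}\le C_p\,\|\nabla f\|_2^{\theta}\,\|f\|_{2p}^{1-\theta},$$ and, furthermore, there is equality when $f(x)=(1-\|x\|^2)_+^{1/(1-p)}$, up to multiplication by a constant, rescaling, and translation by a vector in $\mathbb{R}^{d-1}\times\{0\}$ (i.e. for $f(x)=c\,(1-\|\lambda(x-a)\|^2)_+^{1/(1-p)}$ with $c\in\mathbb{R}$, $\lambda>0$, $a\in\mathbb{R}^{d-1}\times\{0\}$).
   Context: $\mathbb{R}^d_+=\mathbb{R}^{d-1}\times[0,\infty)$ is the closed half space; functions in $C^\infty(\mathbb{R}^d_+)$ are smooth up to the boundary and need not vanish there. $\|f\|_q=\left(\int_{\mathbb{R}^d_+}|f|^q\right)^{1/q}$ with respect to Lebesgue measure (only a quasi-norm if $q<1$), $\|\nabla f\|_2=\left(\int_{\mathbb{R}^d_+}\|\nabla f\|^2\right)^{1/2}$, and $s_+=\max(s,0)$. The inequality is understood for functions $f$ for which the norms appearing in it are finite. *)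

theory Defs
  imports "HOL-Analysis.Analysis"
begin

text \<open>
  The space of dimension \<open>d \<ge> 1\<close> is \<open>real ^ 'n\<close> with \<open>d = CARD('n)\<close>. The distinguished index \<open>k\<close>
  plays the role of the last coordinate, so that the hyperplane of dimension \<open>d - 1\<close> bounding the
  half space is given by \<open>x $ k = 0\<close>.
\<close>

definition half_space :: "'n::finite \<Rightarrow> (real ^ 'n) set"
  where "half_space k = {x. x $ k \<ge> 0}"

definition has_gradient_within :: "('a::euclidean_space \<Rightarrow> real) \<Rightarrow> 'a \<Rightarrow> 'a \<Rightarrow> 'a set \<Rightarrow> bool"
  where "has_gradient_within f g x S \<longleftrightarrow> (f has_derivative (\<lambda>v. g \<bullet> v)) (at x within S)"

text \<open>
  Derivatives within \<open>S\<close> are unique at every point of a closed half space, so there \<open>gradient_within\<close>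
  is the usual gradient in the interior and the one-sided gradient on the boundary.
\<close>

definition gradient_within :: "'a::euclidean_space set \<Rightarrow> ('a \<Rightarrow> real) \<Rightarrow> 'a \<Rightarrow> 'a"
  where "gradient_within S f x = (THE g. has_gradient_within f g x S)"

text \<open>
  \<open>Ck_on m S f\<close>: \<open>f\<close> is \<open>m\<close> times continuously differentiable on \<open>S\<close>. All derivatives are taken
  within \<open>S\<close>; for a closed half space this is differentiability up to the boundary, without any
  condition on the boundary values.
\<close>

primrec Ck_on :: "nat \<Rightarrow> 'a::euclidean_space set \<Rightarrow> ('a \<Rightarrow> real) \<Rightarrow> bool"
  where
    "Ck_on 0 S f \<longleftrightarrow> continuous_on S f"
  | "Ck_on (Suc m) S f \<longleftrightarrow>
       (\<exists>g. (\<forall>x\<in>S. has_gradient_within f (g x) x S) \<and> (\<forall>b\<in>Basis. Ck_on m S (\<lambda>x. g x \<bullet> b)))"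

definition smooth_on :: "'a::euclidean_space set \<Rightarrow> ('a \<Rightarrow> real) \<Rightarrow> bool"
  where "smooth_on S f \<longleftrightarrow> (\<forall>m. Ck_on m S f)"

definition finite_Lnorm :: "'a measure \<Rightarrow> real \<Rightarrow> ('a \<Rightarrow> 'b::real_normed_vector) \<Rightarrow> bool"
  where "finite_Lnorm M q f \<longleftrightarrow> integrable M (\<lambda>x. norm (f x) powr q)"

text \<open>Only meaningful under \<open>finite_Lnorm M q f\<close>: a divergent Bochner integral has value \<open>0\<close>.\<close>

definition Lnorm :: "'a measure \<Rightarrow> real \<Rightarrow> ('a \<Rightarrow> 'b::real_normed_vector) \<Rightarrow> real"
  where "Lnorm M q f = (LINT x|M. norm (f x) powr q) powr (1 / q)"

definition GN_norms_finite :: "real \<Rightarrow> 'n::finite \<Rightarrow> (real ^ 'n \<Rightarrow> real) \<Rightarrow> bool"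
  where "GN_norms_finite p k f \<longleftrightarrow>
    finite_Lnorm (lebesgue_on (half_space k)) (p + 1) f \<and>
    finite_Lnorm (lebesgue_on (half_space k)) 2 (gradient_within (half_space k) f) \<and>
    finite_Lnorm (lebesgue_on (half_space k)) (2 * p) f"

definition extremal :: "real \<Rightarrow> 'a::real_normed_vector \<Rightarrow> real"
  where "extremal p x = max (1 - (norm x)\<^sup>2) 0 powr (1 / (1 - p))"

end

theory Submission
  imports Defs
begin

text \<open>
  Put \<open>d = CARD('n)\<close>, \<open>a = (1 + p) / (1 - p)\<close>, \<open>m = a + d\<close>, write \<open>r\<^sub>+\<close> for \<open>max r 0\<close>, and let \<open>H\<close> be the
  half space. The inequality is the infinitesimal form of a Borell-Brascamp-Lieb inequality, in which
  the function \<open>v = |f| powr (1 - p)\<close> is combined with the concave profile \<open>w y = 1 - |y|\<^sup>2\<close>.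

  Suppose that \<open>V (x + y) \<ge> v x + w y\<close> whenever \<open>v x > 0\<close> and \<open>w y > 0\<close>. Then the functional
  \<open>N v = (\<integral> v\<^sub>+ powr a) powr (1 / m)\<close> satisfies \<open>N V \<ge> N v + N w\<close>, provided that
  \<open>N v\<close> and \<open>N w\<close> are positive. In dimension one this follows by
  comparing level sets, because \<open>|A + B| \<ge> |A| + |B|\<close> on the line; since the one-dimensional
  statement turns the exponent \<open>a\<close> into \<open>a + 1\<close>, it iterates over the coordinates
  (\<open>sup_convolution_integral\<close>).

  Replace \<open>w\<close> by \<open>t w (\<cdot> / t)\<close> and let \<open>t\<close> tend to \<open>0\<close>. Since \<open>- \<nabla>v \<cdot> y - |y|\<^sup>2 \<le> |\<nabla>v|\<^sup>2 / 4\<close>, up to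
  first order \<open>V\<close> may be taken to be \<open>v + t (1 + |\<nabla>v|\<^sup>2 / 4)\<close>, and the derivative at \<open>t = 0\<close> of the
  integral inequality is
  \<open>a \<integral> v\<^sub>+ powr (a - 1) (1 + |\<nabla>v|\<^sup>2 / 4) \<ge> m A powr (1 - 1 / m) B powr (1 / m)\<close>
  with \<open>A = \<integral> v\<^sub>+ powr a\<close> and \<open>B = \<integral> w\<^sub>+ powr a\<close>, all integrals being over \<open>H\<close>
  (\<open>sup_convolution_first_order\<close>). Only points \<open>x\<close>, \<open>y\<close> of \<open>H\<close> enter and \<open>H\<close> is a convex cone, so no
  boundary term appears. For \<open>v = |f| powr (1 - p)\<close> this reads
  \<open>a (\<integral> |f| powr (2 p) + (1 - p)\<^sup>2 / 4 \<integral> |\<nabla>f|\<^sup>2) \<ge> m (\<integral> |f| powr (1 + p)) powr (1 - 1 / m) B powr (1 / m)\<close>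
  (\<open>GN_functional\<close>); as \<open>v\<close> need be neither differentiable nor compactly supported, this needs an
  approximation of \<open>v\<close>.

  The function \<open>(w\<^sub>+) powr (1 / (1 - p))\<close> gives equality in the last inequality
  (\<open>extremal_saturates_GN_functional\<close> is the converse estimate for this function). Applying
  the inequality to \<open>\<mu> f\<close> and choosing \<open>\<mu>\<close> such that its two left-hand terms are in the same
  proportion as for this extremal function turns it into the multiplicative inequality, with the
  constant that is attained at the extremal function (\<open>GN_optimise\<close>).
\<close>

section \<open>The integral of a sup-convolution on the line\<close>

lemma emeasure_lborel_translate:
  fixes A :: "real set"
  assumes "A \<in> sets borel"
  shows "emeasure lborel ((\<lambda>z. z - c) -` A) = emeasure lborel A"
proof -
  have "emeasure lborel A = emeasure (distr lborel borel ((+) (- c))) A"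
    by (simp add: lborel_distr_plus)
  also have "\<dots> = emeasure lborel ((+) (- c) -` A)"
    using assms by (subst emeasure_distr) auto
  also have "(+) (- c) -` A = (\<lambda>z. z - c) -` A" by auto
  finally show ?thesis by simp
qed

text \<open>
  The translates \<open>A + y\<close> and \<open>x + B\<close> are both contained in \<open>A + B\<close>. If \<open>x\<close> is almost the supremum of
  \<open>A\<close> and \<open>y\<close> almost the infimum of \<open>B\<close>, then \<open>A + y\<close> lies almost entirely to the left of \<open>x + B\<close>, so
  that the two measures add up, with a small error.
\<close>
lemma emeasure_sumset_ge_bounded:
  fixes A B C :: "real set"
  assumes ms [measurable]: "A \<in> sets borel" "B \<in> sets borel" "C \<in> sets borel"
    and ne: "A \<noteq> {}" "B \<noteq> {}" and bd: "bdd_above A" "bdd_below B"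
    and sum: "\<And>x y. x \<in> A \<Longrightarrow> y \<in> B \<Longrightarrow> x + y \<in> C"
  shows "emeasure lborel A + emeasure lborel B \<le> emeasure lborel C"
proof (rule ennreal_le_epsilon)
  fix e :: real assume "0 < e"
  obtain x where x: "x \<in> A" "Sup A - e/2 < x"
    using less_cSupD[OF ne(1), of "Sup A - e/2"] \<open>0 < e\<close> by auto
  obtain y where y: "y \<in> B" "y < Inf B + e/2"
    using cInf_lessD[OF ne(2), of "Inf B + e/2"] \<open>0 < e\<close> by auto
  let ?A = "(\<lambda>z. z - y) -` A" and ?B = "(\<lambda>z. z - x) -` B"
  have "(\<lambda>z. z - y) -` A \<in> sets borel"
    by (rule measurable_sets_borel[OF _ ms(1)]) measurable
  moreover have "(\<lambda>z. z - x) -` B \<in> sets borel"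
    by (rule measurable_sets_borel[OF _ ms(2)]) measurable
  ultimately have mA: "?A \<in> sets lborel" "?B \<in> sets lborel" by simp_all
  have "emeasure lborel A + emeasure lborel B = emeasure lborel ?A + emeasure lborel ?B"
    by (simp add: emeasure_lborel_translate)
  also have "\<dots> = emeasure lborel (?A \<union> ?B) + emeasure lborel (?A \<inter> ?B)"
    by (rule emeasure_Un_Int) (fact mA)+
  also have "\<dots> \<le> emeasure lborel C + emeasure lborel {x + Inf B .. Sup A + y}"
  proof (intro add_mono emeasure_mono)
    show "?A \<union> ?B \<subseteq> C" using sum x(1) y(1) by (force dest: sum)
    show "?A \<inter> ?B \<subseteq> {x + Inf B .. Sup A + y}"
      using cSup_upper[OF _ bd(1)] cInf_lower[OF _ bd(2)] by (force simp: algebra_simps)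
  qed auto
  also have "emeasure lborel {x + Inf B .. Sup A + y} \<le> ennreal e"
    using x y \<open>0 < e\<close> by (cases "x + Inf B \<le> Sup A + y") (auto intro!: ennreal_leI)
  finally show "emeasure lborel A + emeasure lborel B \<le> emeasure lborel C + ennreal e"
    by (simp add: add_left_mono)
qed

lemma emeasure_sumset_ge:
  fixes A B C :: "real set"
  assumes [measurable]: "A \<in> sets borel" "B \<in> sets borel" "C \<in> sets borel"
    and ne: "A \<noteq> {}" "B \<noteq> {}"
    and sum: "\<And>x y. x \<in> A \<Longrightarrow> y \<in> B \<Longrightarrow> x + y \<in> C"
  shows "emeasure lborel A + emeasure lborel B \<le> emeasure lborel C"
proof -
  define A' B' where "A' = (\<lambda>n::nat. A \<inter> {.. real n})" and "B' = (\<lambda>n::nat. B \<inter> {- real n ..})"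
  have lim: "(\<lambda>n. emeasure lborel (A' n)) \<longlonglongrightarrow> emeasure lborel (\<Union>n. A' n)"
      "(\<lambda>n. emeasure lborel (B' n)) \<longlonglongrightarrow> emeasure lborel (\<Union>n. B' n)"
    by (rule Lim_emeasure_incseq; auto simp: A'_def B'_def incseq_def)+
  have U: "(\<Union>n. A' n) = A" "(\<Union>n. B' n) = B"
  proof -
    have "\<exists>n. - real n \<le> x" for x
      using real_arch_simple[of "- x"] by (metis minus_le_iff)
    then show "(\<Union>n. A' n) = A" "(\<Union>n. B' n) = B"
      by (auto simp: A'_def B'_def real_arch_simple)
  qed
  obtain x y where xy: "x \<in> A" "y \<in> B" using ne by auto
  obtain N where N: "max x (- y) \<le> real N" using real_arch_simple by blast
  have "emeasure lborel (A' n) + emeasure lborel (B' n) \<le> emeasure lborel C" if "n \<ge> N" for n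
  proof (rule emeasure_sumset_ge_bounded)
    have "x \<in> A' n" "y \<in> B' n" using xy N that by (auto simp: A'_def B'_def)
    then show "A' n \<noteq> {}" "B' n \<noteq> {}" by auto
  qed (auto simp: A'_def B'_def sum)
  then show ?thesis
    using tendsto_add[OF lim] unfolding U
    by (intro LIMSEQ_le_const2[of _ "emeasure lborel A + emeasure lborel B"]) auto
qed

lemma nn_integral_layer_cake:
  fixes f :: "'a::euclidean_space \<Rightarrow> real"
  assumes [measurable]: "f \<in> borel_measurable borel" and "\<And>x. 0 \<le> f x"
  shows "(\<integral>\<^sup>+x. ennreal (f x) \<partial>lborel) = (\<integral>\<^sup>+s. indicator {0<..} s * emeasure lborel {x. s \<le> f x} \<partial>lborel)"
proof -
  have "(\<integral>\<^sup>+x. ennreal (f x) \<partial>lborel)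
      = (\<integral>\<^sup>+x. \<integral>\<^sup>+s. indicator {0<..} s * indicator {s. s \<le> f x} s \<partial>lborel \<partial>lborel)"
  proof (rule nn_integral_cong)
    fix x
    have "(\<integral>\<^sup>+s. indicator {0<..} s * indicator {s. s \<le> f x} s \<partial>lborel) = (\<integral>\<^sup>+s. indicator {0<..f x} s \<partial>lborel)"
      by (intro nn_integral_cong) (auto split: split_indicator)
    then show "ennreal (f x) = (\<integral>\<^sup>+s. indicator {0<..} s * indicator {s. s \<le> f x} s \<partial>lborel)"
      using assms by simp
  qed
  also have "\<dots> = (\<integral>\<^sup>+s. \<integral>\<^sup>+x. indicator {0<..} s * indicator {s. s \<le> f x} s \<partial>lborel \<partial>lborel)"
    by (rule lborel_pair.Fubini') measurable
  also have "\<dots> = (\<integral>\<^sup>+s. indicator {0<..} s * emeasure lborel {x. s \<le> f x} \<partial>lborel)"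
  proof (rule nn_integral_cong)
    fix s :: real
    have "(\<lambda>x. indicator {s. s \<le> f x} s) = (indicator {x. s \<le> f x} :: 'a \<Rightarrow> ennreal)"
      by (auto split: split_indicator)
    then have "(\<integral>\<^sup>+x. indicator {0<..} s * indicator {s. s \<le> f x} s \<partial>lborel)
       = indicator {0<..} s * (\<integral>\<^sup>+x. indicator {x. s \<le> f x} x \<partial>lborel)"
      by (auto split: split_indicator)
    then show "(\<integral>\<^sup>+x. indicator {0<..} s * indicator {s. s \<le> f x} s \<partial>lborel)
       = indicator {0<..} s * emeasure lborel {x. s \<le> f x}"
      using nn_integral_indicator[of "{x. s \<le> f x}" lborel] by simp
  qed
  finally show ?thesis .
qed

text \<open>
  By the layer cake formula the comparison holds as soon as it holds for the measures of almost all
  level sets; the bound \<open>1\<close> on \<open>f\<close> and \<open>g\<close> makes the levels above \<open>1\<close> harmless. When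
  both suprema are \<open>1\<close>, the levels below \<open>1\<close> are those that both functions exceed somewhere, so that the
  measures of sums of level sets can be used.
\<close>
lemma nn_integral_add_le_of_level_sets:
  fixes f g h :: "'a::euclidean_space \<Rightarrow> real"
  assumes [measurable]: "f \<in> borel_measurable borel" "g \<in> borel_measurable borel" "h \<in> borel_measurable borel"
    and nn: "\<And>x. 0 \<le> f x" "\<And>x. 0 \<le> g x" "\<And>x. 0 \<le> h x"
    and le1: "\<And>x. f x \<le> 1" "\<And>x. g x \<le> 1"
    and lev: "\<And>s. 0 < s \<Longrightarrow> s < 1 \<Longrightarrow>
      emeasure lborel {x. s \<le> f x} + emeasure lborel {x. s \<le> g x} \<le> emeasure lborel {x. s \<le> h x}"
  shows "(\<integral>\<^sup>+x. ennreal (f x) \<partial>lborel) + (\<integral>\<^sup>+x. ennreal (g x) \<partial>lborel) \<le> (\<integral>\<^sup>+x. ennreal (h x) \<partial>lborel)"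
proof -
  have m: "(\<lambda>s. indicator {0<..} s * emeasure lborel {x. s \<le> k x}) \<in> borel_measurable lborel"
    if [measurable]: "k \<in> borel_measurable borel" for k :: "'a \<Rightarrow> real"
  proof -
    have "{p \<in> space (borel \<Otimes>\<^sub>M lborel). fst p \<le> k (snd p)} \<in> sets (borel \<Otimes>\<^sub>M lborel)" by measurable
    from sigma_finite_measure.measurable_emeasure_Pair[OF sigma_finite_lborel this]
    show ?thesis by (simp add: vimage_def space_pair_measure)
  qed
  have "indicator {0<..} s * emeasure lborel {x. s \<le> f x} + indicator {0<..} s * emeasure lborel {x. s \<le> g x}
     \<le> indicator {0<..} s * emeasure lborel {x. s \<le> h x}" if "s \<noteq> 1" for s
  proof (cases "0 < s \<and> s < 1")
    case True then show ?thesis using lev[of s] by simp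
  next
    case False
    have "{x. s \<le> f x} = {}" "{x. s \<le> g x} = {}" if "1 < s"
      using le1 that by (auto simp: not_le intro: le_less_trans)
    then show ?thesis using False that by (auto split: split_indicator)
  qed
  moreover have "AE s in lborel. s \<noteq> (1::real)" by (rule AE_lborel_singleton)
  ultimately show ?thesis
    unfolding nn_integral_layer_cake[OF assms(1) nn(1)] nn_integral_layer_cake[OF assms(2) nn(2)]
      nn_integral_layer_cake[OF assms(3) nn(3)]
    by (subst nn_integral_add[symmetric]) (auto intro!: nn_integral_mono_AE m)
qed

text \<open>
  Jensen's inequality for the convex function \<open>x powr (a + 1)\<close> at the points \<open>\<alpha> / M\<close> and \<open>\<beta> / m\<close> with
  weights \<open>M / (M + m)\<close> and \<open>m / (M + m)\<close>.
\<close>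
lemma powr_perspective_convex:
  fixes \<alpha> \<beta> M m a :: real
  assumes "0 < \<alpha>" "0 < \<beta>" "0 < M" "0 < m" "0 < a"
  shows "(\<alpha> + \<beta>) powr (a + 1)
    \<le> (M + m) powr a * (\<alpha> powr (a + 1) / M powr a + \<beta> powr (a + 1) / m powr a)"
proof -
  have c: "convex_on {0<..} (\<lambda>x::real. x powr (a + 1))" using assms by (intro powr_convex) auto
  have "(M / (M + m) * (\<alpha> / M) + m / (M + m) * (\<beta> / m)) powr (a + 1)
     \<le> M / (M + m) * (\<alpha> / M) powr (a + 1) + m / (M + m) * (\<beta> / m) powr (a + 1)"
    using convex_onD[OF c, of "m / (M + m)" "\<alpha> / M" "\<beta> / m"] assms
    by (simp add: field_simps)
  also have "M / (M + m) * (\<alpha> / M) + m / (M + m) * (\<beta> / m) = (\<alpha> + \<beta>) / (M + m)"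
    using assms by (simp add: add_divide_distrib)
  finally have "(\<alpha> + \<beta>) powr (a + 1) \<le> (M + m) powr (a + 1) *
      (M / (M + m) * (\<alpha> / M) powr (a + 1) + m / (M + m) * (\<beta> / m) powr (a + 1))"
    using assms by (simp add: powr_divide field_simps)
  also have "\<dots> = (M + m) powr a * (\<alpha> powr (a + 1) / M powr a + \<beta> powr (a + 1) / m powr a)"
  proof -
    have "(M + m) powr (a + 1) * (K / (M + m) * (\<gamma> / K) powr (a + 1)) = (M + m) powr a * (\<gamma> powr (a + 1) / K powr a)"
      if "0 < K" "0 < \<gamma>" for K \<gamma>
      using assms that by (simp add: powr_divide powr_add)
    then show ?thesis using assms by (simp add: distrib_left)
  qed
  finally show ?thesis .
qed

text \<open>
  The hypothesis says \<open>K (x + y) powr (1 / a) \<ge> f x powr (1 / a) + g y powr (1 / a)\<close> at points where both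
  summands are positive, and the conclusion says the same of the integrals with the exponent
  \<open>1 / (a + 1)\<close>. Avoiding roots in this way lets \<open>K\<close> and its integral be infinite without case
  distinctions, and makes the conclusion have the form of the hypothesis.

  Let \<open>M powr a\<close> and \<open>m powr a\<close> be the suprema of \<open>f\<close> and \<open>g\<close>. For \<open>0 < s < 1\<close> the sets
  \<open>{f \<ge> s M powr a}\<close> and \<open>{g \<ge> s m powr a}\<close> are nonempty and their sum lies in
  \<open>{K \<ge> s (M + m) powr a}\<close>. Integrating over \<open>s\<close> shows that the integrals of the three normalised
  functions compare additively, and \<open>powr_perspective_convex\<close> removes the dependence on \<open>M\<close> and \<open>m\<close>.
\<close>
lemma sup_convolution_integral_real_bounded:
  fixes f g :: "real \<Rightarrow> real" and K :: "real \<Rightarrow> ennreal" and a \<alpha> \<beta> :: real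
  assumes ms [measurable]: "f \<in> borel_measurable borel" "g \<in> borel_measurable borel" "K \<in> borel_measurable borel"
    and nn: "\<And>x. 0 \<le> f x" "\<And>x. 0 \<le> g x"
    and bd: "bdd_above (range f)" "bdd_above (range g)" and a: "0 < a"
    and hyp: "\<And>x y \<alpha> \<beta>. \<lbrakk>0 < \<alpha>; 0 < \<beta>; \<alpha> powr a \<le> f x; \<beta> powr a \<le> g y\<rbrakk>
       \<Longrightarrow> ennreal ((\<alpha> + \<beta>) powr a) \<le> K (x + y)"
    and pos: "0 < \<alpha>" "0 < \<beta>"
    and F: "ennreal (\<alpha> powr (a + 1)) \<le> (\<integral>\<^sup>+x. ennreal (f x) \<partial>lborel)"
    and G: "ennreal (\<beta> powr (a + 1)) \<le> (\<integral>\<^sup>+x. ennreal (g x) \<partial>lborel)"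
  shows "ennreal ((\<alpha> + \<beta>) powr (a + 1)) \<le> (\<integral>\<^sup>+x. K x \<partial>lborel)"
proof -
  define S T where "S = Sup (range f)" and "T = Sup (range g)"
  have le: "f x \<le> S" "g x \<le> T" for x
    using bd by (auto simp: S_def T_def intro: cSup_upper)
  have "0 < S"
  proof (rule ccontr)
    assume "\<not> 0 < S"
    then have "f x = 0" for x using le(1)[of x] nn(1)[of x] by linarith
    then show False using F pos by simp
  qed
  have "0 < T"
  proof (rule ccontr)
    assume "\<not> 0 < T"
    then have "g x = 0" for x using le(2)[of x] nn(2)[of x] by linarith
    then show False using G pos by simp
  qed
  define M m where "M = S powr (1 / a)" and "m = T powr (1 / a)"
  have Mm: "0 < M" "0 < m" "M powr a = S" "m powr a = T"
    using \<open>0 < S\<close> \<open>0 < T\<close> a by (auto simp: M_def m_def powr_powr)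
  define Q where "Q = (M + m) powr a"
  have Q: "0 < Q" using Mm by (simp add: Q_def)
  define h where "h z = enn2real (min (K z) (ennreal Q)) / Q" for z
  have [measurable]: "h \<in> borel_measurable borel" unfolding h_def by measurable
  have hnn: "0 \<le> h z" for z using Q by (simp add: h_def)
  have main: "(\<integral>\<^sup>+x. ennreal (f x / S) \<partial>lborel) + (\<integral>\<^sup>+x. ennreal (g x / T) \<partial>lborel) \<le> (\<integral>\<^sup>+x. ennreal (h x) \<partial>lborel)"
  proof (rule nn_integral_add_le_of_level_sets)
    fix s :: real assume s: "0 < s" "s < 1"
    show "emeasure lborel {x. s \<le> f x / S} + emeasure lborel {x. s \<le> g x / T} \<le> emeasure lborel {x. s \<le> h x}"
    proof (rule emeasure_sumset_ge)
      have "s * S < S" "s * T < T" using s \<open>0 < S\<close> \<open>0 < T\<close> by auto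
      then obtain x y where "s * S < f x" "s * T < g y"
        using less_cSupD[of "range f" "s * S"] less_cSupD[of "range g" "s * T"] unfolding S_def T_def by auto
      then show "{x. s \<le> f x / S} \<noteq> {}" "{x. s \<le> g x / T} \<noteq> {}"
        using \<open>0 < S\<close> \<open>0 < T\<close> by (auto simp: field_simps intro!: exI less_imp_le)
    next
      fix x y assume "x \<in> {x. s \<le> f x / S}" "y \<in> {x. s \<le> g x / T}"
      then have xy: "s * S \<le> f x" "s * T \<le> g y" using \<open>0 < S\<close> \<open>0 < T\<close> by (auto simp: field_simps)
      define r where "r = s powr (1 / a)"
      have r: "0 < r" "r powr a = s" using s a by (auto simp: r_def powr_powr)
      have "ennreal ((r * M + r * m) powr a) \<le> K (x + y)"
        using xy r Mm by (intro hyp) (auto simp: powr_mult)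
      moreover have "(r * M + r * m) powr a = s * Q"
        using r Mm by (simp add: Q_def powr_mult flip: distrib_left)
      ultimately have "ennreal (s * Q) \<le> min (K (x + y)) (ennreal Q)"
        using s Q by (auto intro!: ennreal_leI)
      then have "s * Q \<le> enn2real (min (K (x + y)) (ennreal Q))"
        using s Q by (subst enn2real_ennreal[symmetric], simp, intro enn2real_mono)
          (auto simp: min_less_iff_disj)
      then show "x + y \<in> {x. s \<le> h x}" using Q by (simp add: h_def field_simps)
    qed auto
  qed (use nn le hnn \<open>0 < S\<close> \<open>0 < T\<close> in auto)
  have IS: "(\<integral>\<^sup>+x. ennreal (f x / S) \<partial>lborel) \<ge> ennreal (\<alpha> powr (a + 1) / S)"
  proof -
    have "(\<integral>\<^sup>+x. ennreal (f x) * ennreal (1 / S) \<partial>lborel) = (\<integral>\<^sup>+x. ennreal (f x) \<partial>lborel) * ennreal (1 / S)"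
      by (rule nn_integral_multc) measurable
    then show ?thesis using F \<open>0 < S\<close> nn
      by (simp add: ennreal_mult'[symmetric] divide_inverse)
        (metis ennreal_mult'' inverse_nonnegative_iff_nonnegative less_imp_le mult_right_mono zero_le)
  qed
  have IT: "(\<integral>\<^sup>+x. ennreal (g x / T) \<partial>lborel) \<ge> ennreal (\<beta> powr (a + 1) / T)"
  proof -
    have "(\<integral>\<^sup>+x. ennreal (g x) * ennreal (1 / T) \<partial>lborel) = (\<integral>\<^sup>+x. ennreal (g x) \<partial>lborel) * ennreal (1 / T)"
      by (rule nn_integral_multc) measurable
    then show ?thesis using G \<open>0 < T\<close> nn
      by (simp add: ennreal_mult'[symmetric] divide_inverse)
        (metis ennreal_mult'' inverse_nonnegative_iff_nonnegative less_imp_le mult_right_mono zero_le)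
  qed
  have "ennreal ((\<alpha> + \<beta>) powr (a + 1)) \<le> ennreal (Q * (\<alpha> powr (a + 1) / S + \<beta> powr (a + 1) / T))"
    using powr_perspective_convex[OF pos Mm(1,2) a] by (intro ennreal_leI) (simp add: Q_def Mm)
  also have "\<dots> = ennreal Q * (ennreal (\<alpha> powr (a + 1) / S) + ennreal (\<beta> powr (a + 1) / T))"
    using Q \<open>0 < S\<close> \<open>0 < T\<close> by (simp add: ennreal_mult' flip: ennreal_plus)
  also have "\<dots> \<le> ennreal Q * (\<integral>\<^sup>+x. ennreal (h x) \<partial>lborel)"
    using main IS IT by (intro mult_left_mono order_trans[OF add_mono main]) auto
  also have "\<dots> = (\<integral>\<^sup>+x. ennreal Q * ennreal (h x) \<partial>lborel)"
    by (rule nn_integral_cmult[symmetric]) measurable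
  also have "\<dots> \<le> (\<integral>\<^sup>+x. K x \<partial>lborel)"
  proof (rule nn_integral_mono)
    fix x
    have "ennreal Q * ennreal (h x) = ennreal (enn2real (min (K x) (ennreal Q)))"
      using Q by (simp add: h_def flip: ennreal_mult')
    also have "\<dots> = min (K x) (ennreal Q)" by (rule ennreal_enn2real) (auto simp: min_less_iff_disj)
    finally show "ennreal Q * ennreal (h x) \<le> K x" by simp
  qed
  finally show ?thesis .
qed

text \<open>
  Truncation of \<open>F\<close> and \<open>G\<close> keeps the hypothesis, and by monotone convergence it costs an arbitrarily
  small factor \<open>r < 1\<close> in the lower bounds on the integrals.
\<close>
lemma sup_convolution_integral_real:
  fixes F G K :: "real \<Rightarrow> ennreal" and a \<alpha> \<beta> :: real
  assumes [measurable]: "F \<in> borel_measurable borel" "G \<in> borel_measurable borel" "K \<in> borel_measurable borel"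
    and a: "0 < a"
    and hyp: "\<And>x y \<alpha> \<beta>. \<lbrakk>0 < \<alpha>; 0 < \<beta>; ennreal (\<alpha> powr a) \<le> F x; ennreal (\<beta> powr a) \<le> G y\<rbrakk>
       \<Longrightarrow> ennreal ((\<alpha> + \<beta>) powr a) \<le> K (x + y)"
    and pos: "0 < \<alpha>" "0 < \<beta>"
    and F: "ennreal (\<alpha> powr (a + 1)) \<le> (\<integral>\<^sup>+x. F x \<partial>lborel)"
    and G: "ennreal (\<beta> powr (a + 1)) \<le> (\<integral>\<^sup>+x. G x \<partial>lborel)"
  shows "ennreal ((\<alpha> + \<beta>) powr (a + 1)) \<le> (\<integral>\<^sup>+x. K x \<partial>lborel)"
proof -
  have trunc: "\<exists>N::nat. ennreal (r * \<gamma> powr (a + 1)) \<le> (\<integral>\<^sup>+x. ennreal (enn2real (min (H x) (of_nat N))) \<partial>lborel)"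
    if [measurable]: "H \<in> borel_measurable borel" and r: "0 < r" "r < 1" and "0 < \<gamma>"
      and H: "ennreal (\<gamma> powr (a + 1)) \<le> (\<integral>\<^sup>+x. H x \<partial>lborel)" for H :: "real \<Rightarrow> ennreal" and r \<gamma> :: real
  proof -
    have "ennreal (r * \<gamma> powr (a + 1)) < ennreal (\<gamma> powr (a + 1))"
      using r \<open>0 < \<gamma>\<close> by (simp add: ennreal_less_iff)
    also have "\<dots> \<le> (\<integral>\<^sup>+x. (SUP N. min (H x) (of_nat N)) \<partial>lborel)"
    proof -
      have "(SUP N. min (H x) (of_nat N)) = H x" for x
        using inf_SUP[of "H x" "of_nat :: nat \<Rightarrow> ennreal" UNIV]
        by (simp add: ennreal_SUP_of_nat_eq_top flip: inf_min)
      then show ?thesis using H by simp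
    qed
    also have "\<dots> = (SUP N. \<integral>\<^sup>+x. min (H x) (of_nat N) \<partial>lborel)"
      by (rule nn_integral_monotone_convergence_SUP) (auto simp: incseq_def le_fun_def min.coboundedI2 of_nat_mono)
    finally obtain N where "ennreal (r * \<gamma> powr (a + 1)) < (\<integral>\<^sup>+x. min (H x) (of_nat N) \<partial>lborel)"
      unfolding less_SUP_iff by auto
    moreover have "ennreal (enn2real (min (H x) (of_nat N))) = min (H x) (of_nat N)" for x
      by (rule ennreal_enn2real) (auto simp: min_less_iff_disj of_nat_less_top)
    ultimately show ?thesis by (intro exI[of _ N]) (simp add: less_imp_le)
  qed
  have step: "ennreal (r * (\<alpha> + \<beta>) powr (a + 1)) \<le> (\<integral>\<^sup>+x. K x \<partial>lborel)" if r: "0 < r" "r < 1" for r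
  proof -
    obtain N1 where N1: "ennreal (r * \<alpha> powr (a + 1)) \<le> (\<integral>\<^sup>+x. ennreal (enn2real (min (F x) (of_nat N1))) \<partial>lborel)"
      using trunc[OF _ r pos(1) F] by auto
    obtain N2 where N2: "ennreal (r * \<beta> powr (a + 1)) \<le> (\<integral>\<^sup>+x. ennreal (enn2real (min (G x) (of_nat N2))) \<partial>lborel)"
      using trunc[OF _ r pos(2) G] by auto
    define q where "q = r powr (1 / (a + 1))"
    have q: "0 < q" "q powr (a + 1) = r" using r a by (auto simp: q_def powr_powr)
    have E: "ennreal c \<le> H x" if "c \<le> enn2real (min (H x) (of_nat N))" for c H and x :: real and N :: nat
    proof -
      have "ennreal c \<le> ennreal (enn2real (min (H x) (of_nat N)))" using that by (rule ennreal_leI)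
      also have "\<dots> = min (H x) (of_nat N)" 
        by (rule ennreal_enn2real) (auto simp: min_less_iff_disj of_nat_less_top)
      finally show ?thesis by simp
    qed
    have B: "bdd_above (range (\<lambda>x. enn2real (min (H x) (of_nat N))))" for H :: "real \<Rightarrow> ennreal" and N :: nat
    proof (rule bdd_aboveI2)
      fix x show "enn2real (min (H x) (of_nat N)) \<le> real N"
        using enn2real_mono[of "min (H x) (of_nat N)" "of_nat N"] by (simp add: of_nat_less_top)
    qed
    have "ennreal ((q * \<alpha> + q * \<beta>) powr (a + 1)) \<le> (\<integral>\<^sup>+x. K x \<partial>lborel)"
    proof (rule sup_convolution_integral_real_bounded[where f = "\<lambda>x. enn2real (min (F x) (of_nat N1))"
          and g = "\<lambda>x. enn2real (min (G x) (of_nat N2))"])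
      show "ennreal ((\<alpha>' + \<beta>') powr a) \<le> K (x + y)" if "0 < \<alpha>'" "0 < \<beta>'"
        "\<alpha>' powr a \<le> enn2real (min (F x) (of_nat N1))" "\<beta>' powr a \<le> enn2real (min (G y) (of_nat N2))" for x y \<alpha>' \<beta>'
        using that by (intro hyp) (auto intro: E)
    qed (use q pos a N1 N2 B in \<open>auto simp: powr_mult\<close>)
    moreover have "(q * \<alpha> + q * \<beta>) powr (a + 1) = r * (\<alpha> + \<beta>) powr (a + 1)"
      using q pos by (simp add: powr_mult flip: distrib_left)
    ultimately show ?thesis by simp
  qed
  have "((\<lambda>r. ennreal (r * (\<alpha> + \<beta>) powr (a + 1))) \<longlongrightarrow> ennreal (1 * (\<alpha> + \<beta>) powr (a + 1))) (at_left 1)"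
    by (intro tendsto_intros)
  moreover have "\<forall>\<^sub>F r in at_left (1::real). ennreal (r * (\<alpha> + \<beta>) powr (a + 1)) \<le> (\<integral>\<^sup>+x. K x \<partial>lborel)"
    using eventually_at_left_real[OF zero_less_one] by (rule eventually_mono) (auto intro: step)
  ultimately show ?thesis
    by (metis tendsto_upperbound mult_1 trivial_limit_at_left_real)
qed

section \<open>The integral of a sup-convolution in several variables\<close>

text \<open>
  Fix one coordinate. By the induction hypothesis, the integrals over the remaining coordinates
  satisfy the hypothesis of the one-dimensional statement with \<open>a + card I\<close> in place of \<open>a\<close>, and that
  statement adds the missing \<open>1\<close>.
\<close>
lemma sup_convolution_integral_PiM:
  fixes F G K :: "('i \<Rightarrow> real) \<Rightarrow> ennreal" and a \<alpha> \<beta> :: real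
  assumes "finite I"
    and "F \<in> borel_measurable (PiM I (\<lambda>_. lborel))" "G \<in> borel_measurable (PiM I (\<lambda>_. lborel))"
      "K \<in> borel_measurable (PiM I (\<lambda>_. lborel))"
    and "0 < a"
    and "\<And>x y z \<alpha> \<beta>. \<lbrakk>x \<in> extensional I; y \<in> extensional I; z \<in> extensional I; \<And>i. i \<in> I \<Longrightarrow> z i = x i + y i;
        0 < \<alpha>; 0 < \<beta>; ennreal (\<alpha> powr a) \<le> F x; ennreal (\<beta> powr a) \<le> G y\<rbrakk>
       \<Longrightarrow> ennreal ((\<alpha> + \<beta>) powr a) \<le> K z"
    and "0 < \<alpha>" "0 < \<beta>"
    and "ennreal (\<alpha> powr (a + real (card I))) \<le> (\<integral>\<^sup>+x. F x \<partial>PiM I (\<lambda>_. lborel))"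
    and "ennreal (\<beta> powr (a + real (card I))) \<le> (\<integral>\<^sup>+x. G x \<partial>PiM I (\<lambda>_. lborel))"
  shows "ennreal ((\<alpha> + \<beta>) powr (a + real (card I))) \<le> (\<integral>\<^sup>+x. K x \<partial>PiM I (\<lambda>_. lborel))"
  using assms
proof (induction I arbitrary: F G K \<alpha> \<beta> rule: finite_induct)
  case empty
  interpret product_sigma_finite "\<lambda>_::'i. lborel :: real measure" ..
  have "(\<integral>\<^sup>+x. H x \<partial>PiM {} (\<lambda>_. lborel)) = H (\<lambda>_. undefined)" for H :: "('i \<Rightarrow> real) \<Rightarrow> ennreal"
    by (simp add: PiM_empty nn_integral_count_space_finite)
  with empty.prems(6-) empty.prems(5)[of "\<lambda>_. undefined" "\<lambda>_. undefined" "\<lambda>_. undefined" \<alpha> \<beta>]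
  show ?case by auto
next
  case (insert j I)
  interpret product_sigma_finite "\<lambda>_::'i. lborel :: real measure" ..
  note [measurable] = insert.prems(1-3)
  note int = product_nn_integral_insert_rev[OF insert.hyps(1,2)]
  interpret I: finite_product_sigma_finite "\<lambda>_::'i. lborel :: real measure" I
    by standard (rule insert.hyps(1))
  have m: "(\<lambda>s. \<integral>\<^sup>+x. H (x(j := s)) \<partial>PiM I (\<lambda>_. lborel)) \<in> borel_measurable borel"
    if [measurable]: "H \<in> borel_measurable (PiM (insert j I) (\<lambda>_. lborel))" for H :: "('i \<Rightarrow> real) \<Rightarrow> ennreal"
  proof -
    have "(\<lambda>s. \<integral>\<^sup>+x. H (x(j := s)) \<partial>PiM I (\<lambda>_. lborel)) \<in> borel_measurable lborel"
      by measurable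
    then show ?thesis by simp
  qed
  have c: "a + real (card (insert j I)) = (a + real (card I)) + 1" using insert.hyps by simp
  show ?case
    unfolding c int[OF insert.prems(3)]
  proof (rule sup_convolution_integral_real[where F = "\<lambda>s. \<integral>\<^sup>+x. F (x(j := s)) \<partial>PiM I (\<lambda>_. lborel)"
        and G = "\<lambda>s. \<integral>\<^sup>+x. G (x(j := s)) \<partial>PiM I (\<lambda>_. lborel)"])
    fix s t \<alpha> \<beta> :: real
    assume st: "0 < \<alpha>" "0 < \<beta>"
      "ennreal (\<alpha> powr (a + real (card I))) \<le> (\<integral>\<^sup>+x. F (x(j := s)) \<partial>PiM I (\<lambda>_. lborel))"
      "ennreal (\<beta> powr (a + real (card I))) \<le> (\<integral>\<^sup>+x. G (x(j := t)) \<partial>PiM I (\<lambda>_. lborel))"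
    show "ennreal ((\<alpha> + \<beta>) powr (a + real (card I))) \<le> (\<integral>\<^sup>+x. K (x(j := s + t)) \<partial>PiM I (\<lambda>_. lborel))"
    proof (rule insert.IH[where F = "\<lambda>x. F (x(j := s))" and G = "\<lambda>x. G (x(j := t))"])
      fix x y z \<alpha> \<beta>
      assume *: "x \<in> extensional I" "y \<in> extensional I" "z \<in> extensional I" "\<And>i. i \<in> I \<Longrightarrow> z i = x i + y i"
        "0 < \<alpha>" "0 < \<beta>" "ennreal (\<alpha> powr a) \<le> F (x(j := s))" "ennreal (\<beta> powr a) \<le> G (y(j := t))"
      show "ennreal ((\<alpha> + \<beta>) powr a) \<le> K (z(j := s + t))"
        by (rule insert.prems(5)[OF _ _ _ _ *(5-8)]) (use * in \<open>auto simp: extensional_def\<close>)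
    next
      show "(\<lambda>x. F (x(j := s))) \<in> borel_measurable (PiM I (\<lambda>_. lborel))"
        "(\<lambda>x. G (x(j := t))) \<in> borel_measurable (PiM I (\<lambda>_. lborel))"
        "(\<lambda>x. K (x(j := s + t))) \<in> borel_measurable (PiM I (\<lambda>_. lborel))"
        by measurable
    qed (use st insert.prems(4) in auto)
  qed (use insert.prems m c int in auto)
qed

text \<open>
  The additive form of the Borell-Brascamp-Lieb inequality: if \<open>F\<close>, \<open>G\<close>, \<open>K\<close> are the \<open>a\<close>-th powers of
  \<open>v\<close>, \<open>w\<close> and of their sup-convolution, then the roots of order \<open>a + DIM('a)\<close> of the integrals are
  superadditive.
\<close>
theorem sup_convolution_integral:
  fixes F G K :: "'a::euclidean_space \<Rightarrow> ennreal" and a \<alpha> \<beta> :: real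
  assumes [measurable]: "F \<in> borel_measurable borel" "G \<in> borel_measurable borel" "K \<in> borel_measurable borel"
    and a: "0 < a"
    and hyp: "\<And>x y \<alpha> \<beta>. \<lbrakk>0 < \<alpha>; 0 < \<beta>; ennreal (\<alpha> powr a) \<le> F x; ennreal (\<beta> powr a) \<le> G y\<rbrakk>
       \<Longrightarrow> ennreal ((\<alpha> + \<beta>) powr a) \<le> K (x + y)"
    and pos: "0 < \<alpha>" "0 < \<beta>"
    and F: "ennreal (\<alpha> powr (a + DIM('a))) \<le> (\<integral>\<^sup>+x. F x \<partial>lborel)"
    and G: "ennreal (\<beta> powr (a + DIM('a))) \<le> (\<integral>\<^sup>+x. G x \<partial>lborel)"
  shows "ennreal ((\<alpha> + \<beta>) powr (a + DIM('a))) \<le> (\<integral>\<^sup>+x. K x \<partial>lborel)"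
proof -
  define \<phi> :: "('a \<Rightarrow> real) \<Rightarrow> 'a" where "\<phi> x = (\<Sum>b\<in>Basis. x b *\<^sub>R b)" for x
  have [measurable]: "\<phi> \<in> borel_measurable (\<Pi>\<^sub>M b\<in>Basis. lborel)"
    unfolding \<phi>_def by measurable
  have int: "(\<integral>\<^sup>+x. H x \<partial>lborel) = (\<integral>\<^sup>+x. H (\<phi> x) \<partial>(\<Pi>\<^sub>M b\<in>Basis. lborel))"
    if [measurable]: "H \<in> borel_measurable borel" for H :: "'a \<Rightarrow> ennreal"
    unfolding \<phi>_def by (subst lborel_eq, subst nn_integral_distr) auto
  have add: "\<phi> z = \<phi> x + \<phi> y" if "\<And>b. b \<in> Basis \<Longrightarrow> z b = x b + y b" for x y z
    using that by (simp add: \<phi>_def scaleR_left_distrib sum.distrib)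
  show ?thesis
    unfolding int[OF assms(3)]
  proof (rule sup_convolution_integral_PiM[where F = "\<lambda>x. F (\<phi> x)" and G = "\<lambda>x. G (\<phi> x)"])
    fix x y z \<alpha> \<beta>
    assume "\<And>b. b \<in> Basis \<Longrightarrow> z b = x b + y b" "0 < \<alpha>" "0 < \<beta>"
      "ennreal (\<alpha> powr a) \<le> F (\<phi> x)" "ennreal (\<beta> powr a) \<le> G (\<phi> y)"
    then show "ennreal ((\<alpha> + \<beta>) powr a) \<le> K (\<phi> z)"
      using hyp[of \<alpha> \<beta> "\<phi> x" "\<phi> y"] add[of z x y] by simp
  qed (use F G pos a in \<open>auto simp: int[symmetric]\<close>)
qed

section \<open>The first-order form of the sup-convolution inequality\<close>

text \<open>
  Convexity of \<open>s \<mapsto> s\<^sub>+ powr a\<close> on the whole line, in the form in which it is used below: to linearise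
  both sides of an integral inequality in \<open>t\<close> without differentiating under the integral sign. At
  \<open>r \<le> 0\<close> the left-hand side vanishes since \<open>0 powr a = 0\<close> for every \<open>a\<close>, including \<open>a - 1 = 0\<close>.
\<close>
lemma powr_pos_part_above_tangent:
  fixes a r s :: real
  assumes "1 \<le> a"
  shows "max r 0 powr a + a * max r 0 powr (a - 1) * (s - r) \<le> max s 0 powr a"
proof (cases "r \<le> 0")
  case True
  then show ?thesis by (simp add: max_def)
next
  case False
  then have r: "0 < r" by simp
  have r1: "r powr a = r * r powr (a - 1)"
    using r powr_add[of r 1 "a - 1"] by simp
  show ?thesis
  proof (cases "s \<le> 0")
    case True
    have "r powr a + a * r powr (a - 1) * (s - r) = (1 - a) * r powr a + a * r powr (a - 1) * s"
      by (simp add: r1 algebra_simps)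
    also have "\<dots> \<le> 0"
      using assms r True by (intro add_nonpos_nonpos mult_nonpos_nonneg mult_nonneg_nonpos) auto
    finally show ?thesis using r True by (simp add: max_def)
  next
    case False
    have "a * r powr (a - 1) * (s - r) \<le> s powr a - r powr a"
    proof (rule convex_on_imp_above_tangent[where A = "{0<..}"])
      show "convex_on {0<..} (\<lambda>x. x powr a)" using assms by (rule powr_convex)
      show "((\<lambda>x. x powr a) has_real_derivative a * r powr (a - 1)) (at r within {0<..})"
        using r by (auto intro!: derivative_eq_intros)
    qed (use r False in \<open>auto simp: interior_open\<close>)
    then show ?thesis using r False by (simp add: max_def)
  qed
qed

lemma continuous_on_pos_part_powr:
  fixes v :: "'a::topological_space \<Rightarrow> real"
  assumes "continuous_on S v" "0 < a"
  shows "continuous_on S (\<lambda>x. max (v x) 0 powr a)"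
  using assms by (intro continuous_on_powr' continuous_intros) auto

text \<open>
  The mean value inequality on \<open>C \<inter> ball z d\<close>, with \<open>d\<close> from the uniform continuity of \<open>g\<close>. Derivatives
  are taken within \<open>C\<close>, so boundary points are included.
\<close>
lemma uniform_linearization:
  fixes v :: "'a::euclidean_space \<Rightarrow> real"
  assumes C: "compact C" "convex C"
    and der: "\<And>x. x \<in> C \<Longrightarrow> has_gradient_within v (g x) x C"
    and g: "continuous_on C g" and e: "0 < e"
  obtains d where "0 < d"
    "\<And>x z. \<lbrakk>x \<in> C; z \<in> C; norm (x - z) < d\<rbrakk> \<Longrightarrow> \<bar>v x - v z - g z \<bullet> (x - z)\<bar> \<le> e * norm (x - z)"
proof -
  obtain d where d: "0 < d" "\<And>x z. \<lbrakk>x \<in> C; z \<in> C; dist x z < d\<rbrakk> \<Longrightarrow> dist (g x) (g z) < e"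
    using compact_uniformly_continuous[OF g C(1)] e unfolding uniformly_continuous_on_def by metis
  have "\<bar>v x - v z - g z \<bullet> (x - z)\<bar> \<le> e * norm (x - z)"
    if xz: "x \<in> C" "z \<in> C" "norm (x - z) < d" for x z
  proof -
    define D where "D = C \<inter> ball z d"
    have D: "D \<subseteq> C" "x \<in> D" "z \<in> D" "convex D"
      using xz d(1) C(2) by (auto simp: D_def dist_norm norm_minus_commute convex_Int)
    have "norm (v x - v z - g z \<bullet> (x - z)) \<le> norm (x - z) * e"
    proof (rule differentiable_bound_linearization[where S = D and f' = "\<lambda>x h. g x \<bullet> h"])
      show "z + t *\<^sub>R (x - z) \<in> D" if "t \<in> {0..1}" for t
      proof -
        have "(1 - t) *\<^sub>R z + t *\<^sub>R x \<in> D"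
          using D that by (intro convexD) auto
        then show ?thesis by (simp add: algebra_simps)
      qed
      show "(v has_derivative (\<lambda>h. g y \<bullet> h)) (at y within D)" if "y \<in> D" for y
        using der[of y] that D(1) unfolding has_gradient_within_def
        by (auto intro: has_derivative_subset)
      show "onorm ((\<lambda>h. g y \<bullet> h) - (\<lambda>h. g z \<bullet> h)) \<le> e" if "y \<in> D" for y
      proof (rule onorm_le)
        fix h :: 'a
        have "norm (g y - g z) < e" using d(2)[of y z] that D(1) xz by (auto simp: D_def dist_norm dist_commute norm_minus_commute)
        then have "norm (g y - g z) * norm h \<le> e * norm h" by (intro mult_right_mono) auto
        then show "norm (((\<lambda>h. g y \<bullet> h) - (\<lambda>h. g z \<bullet> h)) h) \<le> e * norm h"
          using Cauchy_Schwarz_ineq2[of "g y - g z" h] by (simp add: inner_diff_left)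
      qed
    qed (rule D)
    then show ?thesis by (simp add: mult.commute)
  qed
  then show ?thesis using that d(1) by blast
qed

lemma nn_integral_eq_set_integral:
  fixes \<phi> :: "'a::euclidean_space \<Rightarrow> real"
  assumes "set_integrable lborel S \<phi>" "\<And>x. x \<in> S \<Longrightarrow> 0 \<le> \<phi> x"
  shows "(\<integral>\<^sup>+x. ennreal (\<phi> x) * indicator S x \<partial>lborel) = ennreal (LINT x:S|lborel. \<phi> x)"
proof -
  have "(\<integral>\<^sup>+x. ennreal (\<phi> x) * indicator S x \<partial>lborel) = (\<integral>\<^sup>+x. ennreal (indicator S x *\<^sub>R \<phi> x) \<partial>lborel)"
    by (intro nn_integral_cong) (auto split: split_indicator)
  also have "\<dots> = ennreal (LINT x:S|lborel. \<phi> x)"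
    using assms unfolding set_integrable_def set_lebesgue_integral_def
    by (intro nn_integral_eq_integral) (auto split: split_indicator)
  finally show ?thesis .
qed

lemma borel_measurable_ennreal_indicator:
  fixes \<phi> :: "'a::euclidean_space \<Rightarrow> real"
  assumes "closed S" "continuous_on S \<phi>"
  shows "(\<lambda>x. ennreal (\<phi> x) * indicator S x) \<in> borel_measurable borel"
proof -
  have [measurable]: "(\<lambda>x. indicator S x *\<^sub>R \<phi> x) \<in> borel_measurable borel"
    using assms by (intro borel_measurable_continuous_on_indicator) auto
  have "(\<lambda>x. ennreal (indicator S x *\<^sub>R \<phi> x)) \<in> borel_measurable borel"
    by measurable
  also have "(\<lambda>x. ennreal (indicator S x *\<^sub>R \<phi> x)) = (\<lambda>x. ennreal (\<phi> x) * indicator S x)"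
    by (auto split: split_indicator)
  finally show ?thesis .
qed

lemma nn_integral_lborel_affine:
  fixes H :: "'a::euclidean_space \<Rightarrow> ennreal"
  assumes [measurable]: "H \<in> borel_measurable borel" and "0 < r"
  shows "(\<integral>\<^sup>+x. H x \<partial>lborel) = ennreal (r ^ DIM('a)) * (\<integral>\<^sup>+x. H (t + r *\<^sub>R x) \<partial>lborel)"
  using assms by (subst lborel_affine[of r t])
     (simp_all add: nn_integral_density nn_integral_distr nn_integral_cmult)

lemma set_integrable_of_bounded_support:
  fixes \<phi> :: "'a::euclidean_space \<Rightarrow> real"
  assumes "closed S" "continuous_on S \<phi>" "\<And>x. x \<in> S \<Longrightarrow> R < norm x \<Longrightarrow> \<phi> x = 0"
  shows "set_integrable lborel S \<phi>"
proof -
  have "integrable lborel (\<lambda>x. indicator (S \<inter> cball 0 R) x *\<^sub>R \<phi> x)"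
    using assms by (intro borel_integrable_compact closed_Int_compact) (auto intro: continuous_on_subset)
  also have "(\<lambda>x. indicator (S \<inter> cball 0 R) x *\<^sub>R \<phi> x) = (\<lambda>x. indicator S x *\<^sub>R \<phi> x)"
    using assms(3) by (auto simp: fun_eq_iff indicator_def not_le)
  finally show ?thesis by (simp add: set_integrable_def)
qed

lemma cone_scaleR_mem_iff:
  assumes "cone S" "0 < r"
  shows "r *\<^sub>R x \<in> S \<longleftrightarrow> x \<in> S"
proof
  assume "r *\<^sub>R x \<in> S"
  then have "(1 / r) *\<^sub>R r *\<^sub>R x \<in> S"
    using assms unfolding cone_def by (metis less_imp_le zero_less_divide_1_iff)
  then show "x \<in> S" using assms by simp
qed (use assms in \<open>auto simp: cone_def\<close>)

lemma pos_part_one_minus_norm_eq_0: "1 < norm x \<Longrightarrow> max (1 - (norm x)\<^sup>2) 0 = 0"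
  using power_mono[of 1 "norm x" 2] by (auto simp: max_def)

lemma convex_cone_add_mem:
  fixes S :: "'a::euclidean_space set"
  assumes "convex S" "cone S" "x \<in> S" "y \<in> S"
  shows "x + y \<in> S"
  using assms convex_cone[of S] by blast

text \<open>
  For \<open>z = x + y\<close> with \<open>|y| < t\<close>, linearisation at \<open>z\<close> and \<open>- g z \<bullet> y \<le> t |g z|\<^sup>2 / 4 + |y|\<^sup>2 / t\<close> show that
  \<open>v x + (t - |y|\<^sup>2 / t) \<le> v z + t (1 + |g z|\<^sup>2 / 4 + e)\<close> for small \<open>t\<close>. The right-hand side therefore
  dominates the sup-convolution of \<open>v\<close> with the rescaled profile \<open>t - |y|\<^sup>2 / t\<close>; being continuous in
  \<open>z\<close>, it can be used instead of the sup-convolution itself. The integral of the \<open>a\<close>-th power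
  of the rescaled profile is \<open>(t \<beta>) powr (a + DIM('a))\<close>. The claim is the first-order term in \<open>t\<close> of
  the resulting inequality \<open>(\<alpha> + t \<beta>) powr (a + DIM('a)) \<le> \<integral> (v + t c)\<^sub>+ powr a\<close>.
\<close>
lemma sup_convolution_first_order:
  fixes v :: "'a::euclidean_space \<Rightarrow> real" and a R \<alpha> \<beta> :: real
  assumes S: "closed S" "convex S" "cone S" and a: "1 < a"
    and der: "\<And>x. x \<in> S \<Longrightarrow> has_gradient_within v (g x) x S"
    and g: "continuous_on S g"
    and R: "0 < R" "\<And>x. \<lbrakk>x \<in> S; 0 < v x\<rbrakk> \<Longrightarrow> norm x \<le> R"
    and \<alpha>: "0 < \<alpha>" "\<alpha> powr (a + DIM('a)) = (LINT x:S|lborel. max (v x) 0 powr a)"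
    and \<beta>: "0 < \<beta>" "\<beta> powr (a + DIM('a)) = (LINT x:S|lborel. max (1 - (norm x)\<^sup>2) 0 powr a)"
  shows "(a + DIM('a)) * \<alpha> powr (a + DIM('a) - 1) * \<beta>
    \<le> a * (LINT x:S|lborel. max (v x) 0 powr (a - 1) * (1 + (norm (g x))\<^sup>2 / 4))"
proof -
  define n where "n = real DIM('a)"
  have n: "0 < n" by (simp add: n_def)
  define C where "C = S \<inter> cball 0 (R + 1)"
  have C: "compact C" "convex C" "C \<subseteq> S" "closed C"
    using S by (auto simp: C_def closed_Int_compact convex_Int)
  have vS: "continuous_on S v"
    using der has_derivative_continuous unfolding has_gradient_within_def continuous_on_eq_continuous_within by blast
  have vC: "continuous_on C v" and gC: "continuous_on C g"
    using vS g C(3) continuous_on_subset by blast+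
  have derC: "has_gradient_within v (g x) x C" if "x \<in> C" for x
    using der[of x] that C(3) unfolding has_gradient_within_def by (auto intro: has_derivative_subset)
  have int: "set_integrable lborel C \<phi>" if "continuous_on C \<phi>" for \<phi> :: "'a \<Rightarrow> real"
    unfolding set_integrable_def using C(1) that by (rule borel_integrable_compact)
  \<comment> \<open>Outside \<open>C\<close> the function \<open>v\<close> is not positive, so all integrals may be taken over \<open>C\<close>.\<close>
  have v0: "max (v x) 0 = 0" if "x \<in> S" "x \<notin> C" for x
    using R(2)[of x] that by (cases "0 < v x") (auto simp: C_def)
  have SC: "(LINT x:S|lborel. \<phi> x) = (LINT x:C|lborel. \<phi> x)" if "\<And>x. x \<in> S \<Longrightarrow> x \<notin> C \<Longrightarrow> \<phi> x = 0" for \<phi> :: "'a \<Rightarrow> real"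
    unfolding set_lebesgue_integral_def
    using that C(3) by (intro Bochner_Integration.integral_cong) (auto split: split_indicator)
  have A_C: "(LINT x:S|lborel. max (v x) 0 powr a) = (LINT x:C|lborel. max (v x) 0 powr a)"
    by (rule SC) (simp add: v0)
  have cont_pow: "continuous_on C (\<lambda>x. max (v x) 0 powr a)" "continuous_on C (\<lambda>x. max (v x) 0 powr (a - 1))"
    using a by (auto intro!: continuous_on_pos_part_powr vC)
  have intB: "(\<integral>\<^sup>+x. ennreal (max (1 - (norm x)\<^sup>2) 0 powr a) * indicator S x \<partial>lborel) = ennreal (\<beta> powr (a + n))"
  proof -
    have "continuous_on S (\<lambda>x. max (1 - (norm x)\<^sup>2) 0 powr a)"
      using a by (intro continuous_on_pos_part_powr continuous_intros) auto
    then have "set_integrable lborel S (\<lambda>x. max (1 - (norm x)\<^sup>2) 0 powr a)"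
      by (rule set_integrable_of_bounded_support[OF S(1), of _ 1]) (simp add: pos_part_one_minus_norm_eq_0)
    then show ?thesis
      using \<beta>(2) by (subst nn_integral_eq_set_integral) (auto simp: n_def)
  qed
  have intA: "(\<integral>\<^sup>+x. ennreal (max (v x) 0 powr a) * indicator S x \<partial>lborel) = ennreal (\<alpha> powr (a + n))"
  proof -
    have "continuous_on S (\<lambda>x. max (v x) 0 powr a)"
      using a by (intro continuous_on_pos_part_powr vS) auto
    then have "set_integrable lborel S (\<lambda>x. max (v x) 0 powr a)"
      by (rule set_integrable_of_bounded_support[OF S(1), of _ "R + 1"]) (auto simp: v0 C_def)
    then show ?thesis
      using \<alpha>(2) by (subst nn_integral_eq_set_integral) (auto simp: n_def)
  qed
  note coneS = cone_scaleR_mem_iff[OF S(3)]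
  have step: "(a + n) * \<alpha> powr (a + n - 1) * \<beta>
      \<le> a * (LINT x:C|lborel. max (v x) 0 powr (a - 1) * (1 + (norm (g x))\<^sup>2 / 4 + e))" if e: "0 < e" for e
  proof -
    define c where "c x = 1 + (norm (g x))\<^sup>2 / 4 + e" for x
    have c: "0 \<le> c x" for x using e by (simp add: c_def)
    have cC: "continuous_on C c" unfolding c_def by (intro continuous_intros gC) auto
    obtain d where d: "0 < d"
      "\<And>x z. \<lbrakk>x \<in> C; z \<in> C; norm (x - z) < d\<rbrakk> \<Longrightarrow> \<bar>v x - v z - g z \<bullet> (x - z)\<bar> \<le> e * norm (x - z)"
      using uniform_linearization[OF C(1,2) derC gC e] by blast
    have conv: "ennreal ((\<alpha> + t * \<beta>) powr (a + n)) \<le> ennreal (LINT z:C|lborel. max (v z + t * c z) 0 powr a)"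
      if t: "0 < t" "t < 1" "t < d" for t
    proof -
      \<comment> \<open>\<open>K\<close> is cut off at radius \<open>R + 1\<close>, which the points \<open>x + y\<close> do not exceed since \<open>|y| < t < 1\<close>.\<close>
      define F where "F x = ennreal (max (v x) 0 powr a) * indicator S x" for x
      define G where "G y = ennreal (max (t - (norm y)\<^sup>2 / t) 0 powr a) * indicator S y" for y :: 'a
      define K where "K z = ennreal (max (v z + t * c z) 0 powr a) * indicator C z" for z
      have Gm [measurable]: "G \<in> borel_measurable borel" unfolding G_def using a t S
        by (intro borel_measurable_ennreal_indicator continuous_on_pos_part_powr continuous_intros) auto
      have Kc: "continuous_on C (\<lambda>z. max (v z + t * c z) 0 powr a)" using a
        by (intro continuous_on_pos_part_powr continuous_intros vC cC) auto
      have "(\<integral>\<^sup>+y. G y \<partial>lborel) = ennreal (t ^ DIM('a)) * (\<integral>\<^sup>+y. G (0 + t *\<^sub>R y) \<partial>lborel)"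
        by (rule nn_integral_lborel_affine) (use Gm t in auto)
      also have "(\<lambda>y. G (0 + t *\<^sub>R y)) = (\<lambda>y::'a. ennreal (t powr a) * (ennreal (max (1 - (norm y)\<^sup>2) 0 powr a) * indicator S y))"
      proof
        fix y :: 'a
        have "max (t - (norm (t *\<^sub>R y))\<^sup>2 / t) 0 = t * max (1 - (norm y)\<^sup>2) 0"
          using t by (simp add: max_mult_distrib_left power_mult_distrib power2_eq_square algebra_simps)
        then show "G (0 + t *\<^sub>R y) = ennreal (t powr a) * (ennreal (max (1 - (norm y)\<^sup>2) 0 powr a) * indicator S y)"
          using t coneS[OF t(1), of y] by (simp add: G_def powr_mult ennreal_mult' indicator_def)
      qed
      also have "(\<integral>\<^sup>+y. ennreal (t powr a) * (ennreal (max (1 - (norm y)\<^sup>2) 0 powr a) * indicator S y) \<partial>lborel)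
          = ennreal (t powr a) * ennreal (\<beta> powr (a + n))"
      proof (subst nn_integral_cmult)
        have "(\<lambda>y::'a. ennreal (max (1 - (norm y)\<^sup>2) 0 powr a) * indicator S y) \<in> borel_measurable borel"
          using a S by (intro borel_measurable_ennreal_indicator continuous_on_pos_part_powr continuous_intros) auto
        then show "(\<lambda>y::'a. ennreal (max (1 - (norm y)\<^sup>2) 0 powr a) * indicator S y) \<in> borel_measurable lborel" by simp
      qed (simp only: intB)
      also have "ennreal (t ^ DIM('a)) * (ennreal (t powr a) * ennreal (\<beta> powr (a + n))) = ennreal ((t * \<beta>) powr (a + n))"
        using t \<beta>(1) by (simp add: ennreal_mult'[symmetric] powr_mult powr_add powr_realpow n_def mult_ac)
      finally have intG: "(\<integral>\<^sup>+y. G y \<partial>lborel) = ennreal ((t * \<beta>) powr (a + n))" .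
      have "ennreal ((\<alpha> + t * \<beta>) powr (a + DIM('a))) \<le> (\<integral>\<^sup>+z. K z \<partial>lborel)"
      proof (rule sup_convolution_integral[where F = F and G = G])
        fix x y and \<alpha>' \<beta>' :: real
        assume pos: "0 < \<alpha>'" "0 < \<beta>'" and F: "ennreal (\<alpha>' powr a) \<le> F x" and G: "ennreal (\<beta>' powr a) \<le> G y"
        have powr_le: "s \<le> max r 0" if "0 < s" "s powr a \<le> max r 0 powr a" for s r :: real
          using that a powr_less_mono2[of a "max r 0" s] by linarith
        have ext: "u \<in> S \<and> s \<le> max r 0"
          if "0 < s" "ennreal (s powr a) \<le> ennreal (max r 0 powr a) * indicator S u" for s r :: real and u
        proof (cases "u \<in> S")
          case True
          then have "s powr a \<le> max r 0 powr a" using that by (simp add: ennreal_le_iff)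
          then show ?thesis using True that powr_le by blast
        qed (use that in auto)
        have x: "x \<in> S" "\<alpha>' \<le> max (v x) 0" using ext[OF pos(1) F[unfolded F_def]] by auto
        have y: "y \<in> S" "\<beta>' \<le> max (t - (norm y)\<^sup>2 / t) 0" using ext[OF pos(2) G[unfolded G_def]] by auto
        have mx: "s \<le> r" if "0 < s" "s \<le> max r 0" for s r :: real
          using that by (auto simp: max_def split: if_splits)
        have x': "\<alpha>' \<le> v x" "0 < v x"
          using mx[OF pos(1) x(2)] pos(1) by linarith+
        have y': "\<beta>' \<le> t - (norm y)\<^sup>2 / t" "0 < t - (norm y)\<^sup>2 / t"
          using mx[OF pos(2) y(2)] pos(2) by linarith+
        have "(norm y)\<^sup>2 / t < t" using y'(2) by linarith
        then have "(norm y)\<^sup>2 < t\<^sup>2"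
          unfolding pos_divide_less_eq[OF t(1)] power2_eq_square[of t] .
        then have ny: "norm y < t" using t by (auto intro: power_less_imp_less_base)
        have xC: "x \<in> C" using R(2)[OF x(1) x'(2)] x(1) by (simp add: C_def)
        have zC: "x + y \<in> C"
          using convex_cone_add_mem[OF S(2,3) x(1) y(1)] norm_triangle_ineq[of x y] R(2)[OF x(1) x'(2)] ny t
          by (simp add: C_def)
        have "\<bar>v x - v (x + y) - g (x + y) \<bullet> (x - (x + y))\<bar> \<le> e * norm (x - (x + y))"
          by (rule d(2)) (use xC zC ny t in auto)
        then have 1: "v x \<le> v (x + y) - g (x + y) \<bullet> y + e * norm y" by simp
        have 2: "- (g (x + y) \<bullet> y) \<le> t * (norm (g (x + y)))\<^sup>2 / 4 + (norm y)\<^sup>2 / t"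
        proof -
          define G Y where "G = norm (g (x + y))" and "Y = norm y"
          have "- (g (x + y) \<bullet> y) \<le> G * Y"
            using Cauchy_Schwarz_ineq2[of "g (x + y)" y] by (simp add: G_def Y_def)
          also have "G * Y \<le> t * G\<^sup>2 / 4 + Y\<^sup>2 / t"
          proof -
            have "0 \<le> (t * G / 2 - Y)\<^sup>2 / t" using t by simp
            also have "\<dots> = t * G\<^sup>2 / 4 + Y\<^sup>2 / t - G * Y" using t by (simp add: power2_eq_square field_simps)
            finally show ?thesis by simp
          qed
          finally show ?thesis by (simp add: G_def Y_def)
        qed
        have 3: "e * norm y \<le> e * t" using ny e by simp
        have "t * c (x + y) = t + t * (norm (g (x + y)))\<^sup>2 / 4 + e * t"
          by (simp add: c_def algebra_simps)
        then have "\<alpha>' + \<beta>' \<le> v (x + y) + t * c (x + y)" using 1 2 3 x' y' by linarith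
        then show "ennreal ((\<alpha>' + \<beta>') powr a) \<le> K (x + y)"
          using zC pos a by (auto simp: K_def intro!: ennreal_leI powr_mono2)
      next
        show "F \<in> borel_measurable borel" "K \<in> borel_measurable borel"
          unfolding F_def K_def using S C Kc a vS
          by (auto intro!: borel_measurable_ennreal_indicator continuous_on_pos_part_powr)
        show "ennreal (\<alpha> powr (a + DIM('a))) \<le> (\<integral>\<^sup>+x. F x \<partial>lborel)"
          using intA by (simp add: F_def n_def)
        show "ennreal ((t * \<beta>) powr (a + DIM('a))) \<le> (\<integral>\<^sup>+x. G x \<partial>lborel)"
          using intG by (simp add: n_def)
      qed (use a \<alpha> \<beta> t Gm in auto)
      also have "(\<integral>\<^sup>+z. K z \<partial>lborel) = ennreal (LINT z:C|lborel. max (v z + t * c z) 0 powr a)"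
        unfolding K_def by (rule nn_integral_eq_set_integral[OF int[OF Kc]]) simp
      finally show ?thesis by (simp add: n_def)
    qed
    \<comment> \<open>Both sides are linearised in \<open>t\<close> by the tangent inequality for the power functions.\<close>
    have lin: "(a + n) * \<alpha> powr (a + n - 1) * \<beta> \<le> a * (LINT z:C|lborel. max (v z + t * c z) 0 powr (a - 1) * c z)"
      if t: "0 < t" "t < 1" "t < d" for t
    proof -
      have Kc: "continuous_on C (\<lambda>z. max (v z + t * c z) 0 powr a)"
          "continuous_on C (\<lambda>z. max (v z + t * c z) 0 powr (a - 1) * c z)" using a
        by (auto intro!: continuous_on_pos_part_powr continuous_intros vC cC)
      have "\<alpha> powr (a + n) + (a + n) * \<alpha> powr (a + n - 1) * (t * \<beta>) \<le> (\<alpha> + t * \<beta>) powr (a + n)"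
      proof -
        have "max \<alpha> 0 = \<alpha>" "max (\<alpha> + t * \<beta>) 0 = \<alpha> + t * \<beta>" using \<alpha>(1) \<beta>(1) t(1) by (simp_all add: add_pos_pos)
        then show ?thesis
          using powr_pos_part_above_tangent[of "a + n" \<alpha> "\<alpha> + t * \<beta>"] a n by simp
      qed
      also have "\<dots> \<le> (LINT z:C|lborel. max (v z + t * c z) 0 powr a)"
        using conv[OF t] by (subst (asm) ennreal_le_iff) (auto simp: set_lebesgue_integral_def intro!: integral_nonneg_AE)
      also have "\<dots> \<le> (LINT z:C|lborel. max (v z) 0 powr a + t * a * (max (v z + t * c z) 0 powr (a - 1) * c z))"
      proof (rule set_integral_mono)
        fix z
        show "max (v z + t * c z) 0 powr a \<le> max (v z) 0 powr a + t * a * (max (v z + t * c z) 0 powr (a - 1) * c z)"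
          using powr_pos_part_above_tangent[of a "v z + t * c z" "v z"] a by (simp add: algebra_simps)
      qed (auto intro!: int Kc cont_pow continuous_intros)
      also have "\<dots> = \<alpha> powr (a + n) + t * a * (LINT z:C|lborel. max (v z + t * c z) 0 powr (a - 1) * c z)"
        using \<alpha>(2) by (subst set_integral_add) (auto intro!: int cont_pow continuous_on_mult_left Kc(2) simp: A_C n_def)
      finally show ?thesis using t by (simp add: mult_ac)
    qed
    have contK: "continuous_on C (\<lambda>z. max (v z + s * c z) 0 powr (a - 1) * c z)" for s using a
      by (intro continuous_on_mult continuous_on_pos_part_powr continuous_on_add continuous_on_mult_left vC cC) auto
    have lim: "((\<lambda>j. LINT z:C|lborel. max (v z + 1 / real (Suc j) * c z) 0 powr (a - 1) * c z)
      \<longlongrightarrow> (LINT z:C|lborel. max (v z + 0 * c z) 0 powr (a - 1) * c z)) sequentially"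
      unfolding set_lebesgue_integral_def
    proof (rule integral_dominated_convergence[where w = "\<lambda>z. indicator C z *\<^sub>R (max (\<bar>v z\<bar> + c z) 0 powr (a - 1) * c z)"])
      show "(\<lambda>x. indicator C x *\<^sub>R (max (v x + 0 * c x) 0 powr (a - 1) * c x)) \<in> borel_measurable lborel"
        "(\<lambda>x. indicator C x *\<^sub>R (max (v x + 1 / real (Suc j) * c x) 0 powr (a - 1) * c x)) \<in> borel_measurable lborel" for j
        using borel_measurable_continuous_on_indicator[OF borel_closed[OF C(4)] contK[of 0]]
          borel_measurable_continuous_on_indicator[OF borel_closed[OF C(4)] contK[of "1 / real (Suc j)"]]
        unfolding measurable_lborel2 by blast+
      show "integrable lborel (\<lambda>z. indicator C z *\<^sub>R (max (\<bar>v z\<bar> + c z) 0 powr (a - 1) * c z))"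
        using a by (intro borel_integrable_compact C continuous_on_mult continuous_on_pos_part_powr continuous_on_add
          continuous_on_rabs vC cC) auto
      show "AE x in lborel. (\<lambda>j. indicator C x *\<^sub>R (max (v x + 1 / real (Suc j) * c x) 0 powr (a - 1) * c x))
         \<longlonglongrightarrow> indicator C x *\<^sub>R (max (v x + 0 * c x) 0 powr (a - 1) * c x)"
      proof (rule AE_I2)
        fix x
        have "(\<lambda>j. 1 / real (Suc j)) \<longlonglongrightarrow> 0" using LIMSEQ_inverse_real_of_nat by (simp add: inverse_eq_divide)
        then have "(\<lambda>j. max (v x + 1 / real (Suc j) * c x) 0 powr (a - 1)) \<longlonglongrightarrow> max (v x + 0 * c x) 0 powr (a - 1)"
          using a by (intro tendsto_powr' tendsto_intros) auto
        then show "(\<lambda>j. indicator C x *\<^sub>R (max (v x + 1 / real (Suc j) * c x) 0 powr (a - 1) * c x))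
         \<longlonglongrightarrow> indicator C x *\<^sub>R (max (v x + 0 * c x) 0 powr (a - 1) * c x)"
          by (intro tendsto_scaleR[OF tendsto_const] tendsto_mult[OF _ tendsto_const])
      qed
      show "AE x in lborel. norm (indicator C x *\<^sub>R (max (v x + 1 / real (Suc j) * c x) 0 powr (a - 1) * c x))
         \<le> indicator C x *\<^sub>R (max (\<bar>v x\<bar> + c x) 0 powr (a - 1) * c x)" for j
      proof (rule AE_I2)
        fix x
        have "1 / real (Suc j) * c x \<le> c x" using c[of x] by (simp add: field_simps)
        then have "max (v x + 1 / real (Suc j) * c x) 0 powr (a - 1) \<le> max (\<bar>v x\<bar> + c x) 0 powr (a - 1)"
          using a by (intro powr_mono2) auto
        then show "norm (indicator C x *\<^sub>R (max (v x + 1 / real (Suc j) * c x) 0 powr (a - 1) * c x))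
           \<le> indicator C x *\<^sub>R (max (\<bar>v x\<bar> + c x) 0 powr (a - 1) * c x)"
          using c[of x] by (auto split: split_indicator intro: mult_right_mono)
      qed
    qed
    have "\<forall>\<^sub>F j in sequentially. 1 / real (Suc j) < min d 1"
    proof -
      have "(\<lambda>j. 1 / real (Suc j)) \<longlonglongrightarrow> 0" using LIMSEQ_inverse_real_of_nat by (simp add: inverse_eq_divide)
      then show ?thesis using d(1) by (intro order_tendstoD) auto
    qed
    then have ev: "\<forall>\<^sub>F j in sequentially. (a + n) * \<alpha> powr (a + n - 1) * \<beta>
       \<le> a * (LINT z:C|lborel. max (v z + 1 / real (Suc j) * c z) 0 powr (a - 1) * c z)"
      by (rule eventually_mono) (intro lin, auto)
    have "(a + n) * \<alpha> powr (a + n - 1) * \<beta> \<le> a * (LINT z:C|lborel. max (v z + 0 * c z) 0 powr (a - 1) * c z)"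
      by (rule tendsto_lowerbound[OF tendsto_mult_left[OF lim] ev]) simp
    then show ?thesis by (simp add: c_def)
  qed
  define P where "P = (LINT x:C|lborel. max (v x) 0 powr (a - 1))"
  define Q where "Q = (LINT x:C|lborel. max (v x) 0 powr (a - 1) * (1 + (norm (g x))\<^sup>2 / 4))"
  have "(LINT x:C|lborel. max (v x) 0 powr (a - 1) * (1 + (norm (g x))\<^sup>2 / 4 + e)) = Q + e * P" for e
  proof -
    have "(LINT x:C|lborel. max (v x) 0 powr (a - 1) * (1 + (norm (g x))\<^sup>2 / 4 + e))
       = (LINT x:C|lborel. max (v x) 0 powr (a - 1) * (1 + (norm (g x))\<^sup>2 / 4) + e * max (v x) 0 powr (a - 1))"
      by (simp add: algebra_simps)
    also have "\<dots> = Q + e * P" unfolding P_def Q_def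
      by (subst set_integral_add) (auto intro!: int cont_pow continuous_intros gC)
    finally show ?thesis .
  qed
  then have "\<forall>\<^sub>F e in at_right 0. (a + n) * \<alpha> powr (a + n - 1) * \<beta> \<le> a * (Q + e * P)"
    using step by (auto intro!: eventually_at_rightI[of 0 1])
  moreover have "((\<lambda>e. a * (Q + e * P)) \<longlongrightarrow> a * (Q + 0 * P)) (at_right 0)"
    by (intro tendsto_intros)
  ultimately have "(a + n) * \<alpha> powr (a + n - 1) * \<beta> \<le> a * (Q + 0 * P)"
    by (intro tendsto_lowerbound[where F = "at_right (0::real)"]) auto
  moreover have "Q = (LINT x:S|lborel. max (v x) 0 powr (a - 1) * (1 + (norm (g x))\<^sup>2 / 4))"
    unfolding Q_def by (rule SC[symmetric]) (use a in \<open>simp add: v0\<close>)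
  ultimately show ?thesis by (simp add: n_def)
qed

section \<open>Regularised powers\<close>

text \<open>
  A \<open>C\<^sup>1\<close> substitute for \<open>|y| powr (1 - p)\<close>: the summand \<open>\<delta>\<close> smooths the singularity at \<open>0\<close>, subtracting
  \<open>\<delta> powr ((1 - p) / 2)\<close> keeps the value below \<open>|y| powr (1 - p)\<close>, and the map \<open>q \<mapsto> q / (1 + \<delta> q)\<close> makes
  the result bounded.
\<close>
definition reg_powr :: "real \<Rightarrow> real \<Rightarrow> real \<Rightarrow> real"
  where "reg_powr p \<delta> y = (let q = (y\<^sup>2 + \<delta>) powr ((1 - p) / 2) - \<delta> powr ((1 - p) / 2) in q / (1 + \<delta> * q))"

definition reg_powr_deriv :: "real \<Rightarrow> real \<Rightarrow> real \<Rightarrow> real"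
  where "reg_powr_deriv p \<delta> y = (1 - p) * y * (y\<^sup>2 + \<delta>) powr ((1 - p) / 2 - 1)
    / (1 + \<delta> * ((y\<^sup>2 + \<delta>) powr ((1 - p) / 2) - \<delta> powr ((1 - p) / 2)))\<^sup>2"

lemma powr_subadditive:
  fixes x y s :: real
  assumes "0 \<le> x" "0 \<le> y" "0 < s" "s \<le> 1"
  shows "(x + y) powr s \<le> x powr s + y powr s"
proof (cases "x + y = 0")
  case False
  define t where "t = x + y"
  have t: "0 < t" using False assms by (simp add: t_def)
  have *: "z / t * t powr s \<le> z powr s" if "0 \<le> z" "z \<le> t" for z
  proof (cases "z = 0")
    case False
    have "(z / t) powr 1 \<le> (z / t) powr s" using assms that t False by (intro powr_mono') auto
    then show ?thesis using that t False by (simp add: powr_divide divide_simps)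
  qed auto
  have "(x + y) powr s = x / t * t powr s + y / t * t powr s"
    using t by (simp add: t_def flip: distrib_right add_divide_distrib)
  also have "\<dots> \<le> x powr s + y powr s" using assms by (intro add_mono *) (auto simp: t_def)
  finally show ?thesis .
qed (use assms in auto)

lemma power2_powr_half: "(y\<^sup>2) powr (s / 2) = \<bar>y\<bar> powr s" for y s :: real
proof (cases "y = 0")
  case False
  then have "y\<^sup>2 = \<bar>y\<bar> powr 2" by simp
  then show ?thesis by (simp only: powr_powr) simp
qed simp

context
  fixes p \<delta> :: real
  assumes p: "0 < p" "p < 1" and \<delta>: "0 < \<delta>"
begin

lemma reg_powr_base_bounds:
  "0 \<le> (y\<^sup>2 + \<delta>) powr ((1 - p) / 2) - \<delta> powr ((1 - p) / 2)"
  "(y\<^sup>2 + \<delta>) powr ((1 - p) / 2) - \<delta> powr ((1 - p) / 2) \<le> \<bar>y\<bar> powr (1 - p)"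
proof -
  have "\<delta> powr ((1 - p) / 2) \<le> (y\<^sup>2 + \<delta>) powr ((1 - p) / 2)" using p \<delta> by (intro powr_mono2) auto
  then show "0 \<le> (y\<^sup>2 + \<delta>) powr ((1 - p) / 2) - \<delta> powr ((1 - p) / 2)" by simp
  show "(y\<^sup>2 + \<delta>) powr ((1 - p) / 2) - \<delta> powr ((1 - p) / 2) \<le> \<bar>y\<bar> powr (1 - p)"
    using powr_subadditive[of "y\<^sup>2" \<delta> "(1 - p) / 2"] p \<delta> by (simp add: power2_powr_half)
qed

lemma reg_powr_bounds:
  "0 \<le> reg_powr p \<delta> y" "reg_powr p \<delta> y \<le> \<bar>y\<bar> powr (1 - p)" "reg_powr p \<delta> y \<le> 1 / \<delta>"
  "reg_powr p \<delta> y \<le> (y\<^sup>2 + \<delta>) powr ((1 - p) / 2)"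
proof -
  define q where "q = (y\<^sup>2 + \<delta>) powr ((1 - p) / 2) - \<delta> powr ((1 - p) / 2)"
  have q: "0 \<le> q" "q \<le> \<bar>y\<bar> powr (1 - p)" using reg_powr_base_bounds[of y] by (simp_all add: q_def)
  have e: "reg_powr p \<delta> y = q / (1 + \<delta> * q)" by (simp add: reg_powr_def q_def Let_def)
  have pos: "0 < 1 + \<delta> * q" using q \<delta> by (simp add: add_pos_nonneg)
  have "q \<le> q * (1 + \<delta> * q)" using q \<delta> by (simp add: distrib_left)
  then have le: "reg_powr p \<delta> y \<le> q" unfolding e using pos by (simp add: pos_divide_le_eq)
  show "0 \<le> reg_powr p \<delta> y" unfolding e using q pos by simp
  show "reg_powr p \<delta> y \<le> \<bar>y\<bar> powr (1 - p)" using le q by simp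
  show "reg_powr p \<delta> y \<le> 1 / \<delta>" unfolding e using pos \<delta> by (simp add: divide_simps mult.commute)
  show "reg_powr p \<delta> y \<le> (y\<^sup>2 + \<delta>) powr ((1 - p) / 2)"
    using le powr_ge_zero[of \<delta> "(1 - p) / 2"] unfolding q_def by linarith
qed

lemma has_derivative_reg_powr:
  "(reg_powr p \<delta> has_real_derivative reg_powr_deriv p \<delta> y) (at y)"
proof -
  define Q where "Q y = (y\<^sup>2 + \<delta>) powr ((1 - p) / 2) - \<delta> powr ((1 - p) / 2)" for y
  define Q' where "Q' = (1 - p) * y * (y\<^sup>2 + \<delta>) powr ((1 - p) / 2 - 1)"
  have "0 < y\<^sup>2 + \<delta>" using \<delta> by (simp add: add_nonneg_pos)
  then have "(Q has_real_derivative Q') (at y)"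
    unfolding Q_def Q'_def by (auto intro!: derivative_eq_intros)
  moreover have pos: "0 < 1 + \<delta> * Q y" using reg_powr_base_bounds(1)[of y] \<delta> by (simp add: Q_def add_pos_nonneg)
  ultimately have "((\<lambda>y. Q y / (1 + \<delta> * Q y)) has_real_derivative
     (Q' * (1 + \<delta> * Q y) - Q y * (\<delta> * Q')) / ((1 + \<delta> * Q y) * (1 + \<delta> * Q y))) (at y)"
    by (auto intro!: derivative_eq_intros)
  also have "(Q' * (1 + \<delta> * Q y) - Q y * (\<delta> * Q')) / ((1 + \<delta> * Q y) * (1 + \<delta> * Q y)) = reg_powr_deriv p \<delta> y"
    by (simp add: reg_powr_deriv_def Q_def Q'_def power2_eq_square algebra_simps)
  also have "(\<lambda>y. Q y / (1 + \<delta> * Q y)) = reg_powr p \<delta>"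
    by (simp add: fun_eq_iff reg_powr_def Q_def Let_def)
  finally show ?thesis .
qed

lemma continuous_on_reg_powr_deriv: "continuous_on UNIV (reg_powr_deriv p \<delta>)"
proof -
  have 1: "y\<^sup>2 + \<delta> \<noteq> 0" for y :: real using \<delta> by (smt (verit) zero_le_power2)
  have 2: "1 + \<delta> * ((y\<^sup>2 + \<delta>) powr ((1 - p) / 2) - \<delta> powr ((1 - p) / 2)) \<noteq> 0" for y :: real
    using reg_powr_base_bounds(1)[of y] \<delta> by (smt (verit) mult_nonneg_nonneg)
  show ?thesis unfolding reg_powr_deriv_def
    by (intro continuous_intros) (use 1 2 \<delta> in auto)
qed

text \<open>
  The constant \<open>(1 - p)\<^sup>2\<close> is the value of the left-hand side for \<open>|y| powr (1 - p)\<close> itself, where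
  the powers of \<open>|y|\<close> cancel. It is essential for the sharp constant that regularising does not
  increase it.
\<close>
lemma reg_powr_deriv_bound:
  "reg_powr p \<delta> y powr ((1 + p) / (1 - p) - 1) * (reg_powr_deriv p \<delta> y)\<^sup>2 \<le> (1 - p)\<^sup>2"
proof -
  define z where "z = y\<^sup>2 + \<delta>"
  have z: "0 < z" "y\<^sup>2 \<le> z" using \<delta> by (simp_all add: z_def add_nonneg_pos)
  define D where "D = (1 + \<delta> * (z powr ((1 - p) / 2) - \<delta> powr ((1 - p) / 2)))\<^sup>2"
  have D: "1 \<le> D" unfolding D_def z_def
    using reg_powr_base_bounds(1)[of y] \<delta> by (intro one_le_power) simp
  have e: "(1 + p) / (1 - p) - 1 = 2 * p / (1 - p)" using p by (simp add: field_simps)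
  have "reg_powr p \<delta> y powr ((1 + p) / (1 - p) - 1) \<le> (z powr ((1 - p) / 2)) powr (2 * p / (1 - p))"
    unfolding e using reg_powr_bounds[of y] p by (intro powr_mono2) (auto simp: z_def)
  also have "\<dots> = z powr p" using p by (simp add: powr_powr)
  finally have 1: "reg_powr p \<delta> y powr ((1 + p) / (1 - p) - 1) \<le> z powr p" .
  have "(reg_powr_deriv p \<delta> y)\<^sup>2 = (1 - p)\<^sup>2 * y\<^sup>2 * (z powr ((1 - p) / 2 - 1))\<^sup>2 / D\<^sup>2"
    by (simp add: reg_powr_deriv_def z_def D_def power_divide power_mult_distrib)
  also have "\<dots> \<le> (1 - p)\<^sup>2 * y\<^sup>2 * (z powr ((1 - p) / 2 - 1))\<^sup>2 / 1"
    using D by (intro divide_left_mono) auto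
  also have "\<dots> \<le> (1 - p)\<^sup>2 * z * (z powr ((1 - p) / 2 - 1))\<^sup>2"
    using z by (simp add: mult_left_mono mult_right_mono)
  also have "\<dots> = (1 - p)\<^sup>2 * z powr (- p)"
  proof -
    have "z * (z powr ((1 - p) / 2 - 1))\<^sup>2 = z powr (1 + (((1 - p) / 2 - 1) + ((1 - p) / 2 - 1)))"
      unfolding powr_add power2_eq_square using z by simp
    also have "1 + (((1 - p) / 2 - 1) + ((1 - p) / 2 - 1)) = - p" by (simp add: field_simps)
    finally show ?thesis by (simp add: mult.assoc)
  qed
  finally have 2: "(reg_powr_deriv p \<delta> y)\<^sup>2 \<le> (1 - p)\<^sup>2 * z powr (- p)" .
  have "reg_powr p \<delta> y powr ((1 + p) / (1 - p) - 1) * (reg_powr_deriv p \<delta> y)\<^sup>2 \<le> z powr p * ((1 - p)\<^sup>2 * z powr (- p))"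
    using 1 2 by (intro mult_mono) auto
  also have "\<dots> = (1 - p)\<^sup>2" using z by (simp add: powr_minus)
  finally show ?thesis .
qed

end

lemma tendsto_reg_powr:
  assumes p: "0 < p" "p < 1" and d: "d \<longlonglongrightarrow> 0" "\<And>j. 0 < d j"
  shows "(\<lambda>j. reg_powr p (d j) y) \<longlonglongrightarrow> \<bar>y\<bar> powr (1 - p)"
proof -
  have nn: "0 \<le> d j" for j using d(2)[of j] by simp
  have t1: "(\<lambda>j. d j powr ((1 - p) / 2)) \<longlonglongrightarrow> 0 powr ((1 - p) / 2)"
    by (intro tendsto_powr' tendsto_const d(1)) (use p nn in simp)
  have t2: "(\<lambda>j. (y\<^sup>2 + d j) powr ((1 - p) / 2)) \<longlonglongrightarrow> (y\<^sup>2 + 0) powr ((1 - p) / 2)"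
    by (intro tendsto_powr' tendsto_const tendsto_add d(1)) (use p nn in simp)
  have q: "(\<lambda>j. (y\<^sup>2 + d j) powr ((1 - p) / 2) - d j powr ((1 - p) / 2)) \<longlonglongrightarrow> (y\<^sup>2) powr ((1 - p) / 2)"
    using tendsto_diff[OF t2 t1] p by simp
  have "(\<lambda>j. reg_powr p (d j) y) \<longlonglongrightarrow> (y\<^sup>2) powr ((1 - p) / 2) / (1 + 0 * (y\<^sup>2) powr ((1 - p) / 2))"
    unfolding reg_powr_def Let_def by (intro tendsto_intros q d) simp
  then show ?thesis by (simp add: power2_powr_half)
qed

section \<open>The inequality in additive form\<close>

lemma norm_diff_power2_le:
  fixes b c :: "'a::real_inner"
  assumes "0 < e"
  shows "(norm (b - c))\<^sup>2 \<le> (1 + e) * (norm b)\<^sup>2 + (1 + 1 / e) * (norm c)\<^sup>2"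
proof -
  define s t where "s = norm b" and "t = norm c"
  have "(norm (b - c))\<^sup>2 \<le> (s + t)\<^sup>2"
    unfolding s_def t_def by (intro power_mono norm_triangle_ineq4) auto
  also have "0 \<le> (e * s - t)\<^sup>2 / e" using assms by simp
  then have "(s + t)\<^sup>2 \<le> (1 + e) * s\<^sup>2 + (1 + 1 / e) * t\<^sup>2"
    using assms by (simp add: power2_eq_square field_simps)
  finally show ?thesis by (simp add: s_def t_def)
qed

lemma has_gradient_within_imp_continuous_on:
  assumes "\<And>x. x \<in> S \<Longrightarrow> has_gradient_within f (g x) x S"
  shows "continuous_on S f"
  using assms has_derivative_continuous
  unfolding has_gradient_within_def continuous_on_eq_continuous_within by blast

text \<open>
  The first-order inequality for \<open>v = reg_powr p \<delta> (f x) - \<delta> |x|\<^sup>2\<close>. Subtracting \<open>\<delta> |x|\<^sup>2\<close> cuts the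
  support off, and it does so at a small cost: where \<open>v > 0\<close>, the gradient \<open>2 \<delta> x\<close> of this term satisfies
  \<open>|2 \<delta> x|\<^sup>2 \<le> 4 \<delta> |f| powr (1 - p)\<close>, which multiplied by \<open>v powr (a - 1)\<close> is at most
  \<open>4 \<delta> |f| powr (1 + p)\<close>. Splitting the square of the gradient with weight \<open>e = sqrt \<delta>\<close> makes all error
  terms vanish with \<open>\<delta>\<close>.
\<close>
lemma GN_functional_regularised:
  fixes f :: "'a::euclidean_space \<Rightarrow> real" and p \<delta> :: real
  assumes S: "closed S" "convex S" "cone S" and p: "0 < p" "p < 1" and \<delta>: "0 < \<delta>"
    and der: "\<And>x. x \<in> S \<Longrightarrow> has_gradient_within f (g x) x S"
    and g: "continuous_on S g"
    and X: "set_integrable lborel S (\<lambda>x. \<bar>f x\<bar> powr (2 * p))"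
    and Y: "set_integrable lborel S (\<lambda>x. (norm (g x))\<^sup>2)"
    and A: "set_integrable lborel S (\<lambda>x. \<bar>f x\<bar> powr (1 + p))"
    and a_def: "a = (1 + p) / (1 - p)" and m_def: "m = a + real DIM('a)"
    and B_def: "B = (LINT x:S|lborel. max (1 - (norm x)\<^sup>2) 0 powr a)" and B: "0 < B"
  shows "m * (LINT x:S|lborel. max (reg_powr p \<delta> (f x) - \<delta> * (norm x)\<^sup>2) 0 powr a) powr (1 - 1 / m) * B powr (1 / m)
    \<le> a * ((LINT x:S|lborel. \<bar>f x\<bar> powr (2 * p))
       + (1 + sqrt \<delta>) * (1 - p)\<^sup>2 / 4 * (LINT x:S|lborel. (norm (g x))\<^sup>2)
       + (\<delta> + sqrt \<delta>) * (LINT x:S|lborel. \<bar>f x\<bar> powr (1 + p)))"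
    (is "?L \<le> a * ?R")
proof -
  define u where "u x = reg_powr p \<delta> (f x)" for x
  define k where "k x = reg_powr_deriv p \<delta> (f x)" for x
  define v where "v x = u x - \<delta> * (norm x)\<^sup>2" for x
  define G where "G x = k x *\<^sub>R g x - (2 * \<delta>) *\<^sub>R x" for x
  define A' where "A' = (LINT x:S|lborel. max (v x) 0 powr a)"
  have a: "1 < a" "a - 1 = 2 * p / (1 - p)" "(1 - p) * (a - 1) = 2 * p" "(1 - p) * a = 1 + p"
    using p by (simp_all add: a_def field_simps)
  have m: "1 < m" using a(1) by (simp add: m_def)
  note ub = reg_powr_bounds[OF p \<delta>, of "f x" for x, folded u_def]
  have fS: "continuous_on S f" by (rule has_gradient_within_imp_continuous_on[OF der])
  have derv: "has_gradient_within v (G x) x S" if x: "x \<in> S" for x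
  proof -
    have "(u has_derivative (\<lambda>h. k x * (g x \<bullet> h))) (at x within S)"
      using has_derivative_compose[OF der[OF x, unfolded has_gradient_within_def]
          has_derivative_reg_powr[OF p \<delta>, of "f x", unfolded has_field_derivative_def]]
      unfolding u_def k_def .
    then have "(v has_derivative (\<lambda>h. k x * (g x \<bullet> h) - \<delta> * (2 * (x \<bullet> h)))) (at x within S)"
      unfolding v_def power2_norm_eq_inner
      by (auto intro!: derivative_eq_intros simp: inner_commute)
    moreover have "(\<lambda>h. k x * (g x \<bullet> h) - \<delta> * (2 * (x \<bullet> h))) = (\<lambda>h. G x \<bullet> h)"
      by (simp add: fun_eq_iff G_def inner_diff_left)
    ultimately show ?thesis unfolding has_gradient_within_def by simp
  qed
  have vS: "continuous_on S v" by (rule has_gradient_within_imp_continuous_on[OF derv])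
  have kS: "continuous_on S k"
    unfolding k_def by (rule continuous_on_compose2[OF continuous_on_reg_powr_deriv[OF p \<delta>] fS]) auto
  have GS: "continuous_on S G" unfolding G_def by (intro continuous_intros kS g)
  define W where "W x = max (v x) 0 powr (a - 1) * (1 + (norm (G x))\<^sup>2 / 4)" for x
  define Z where "Z x = \<bar>f x\<bar> powr (2 * p) + ((1 + sqrt \<delta>) * (1 - p)\<^sup>2 / 4) * (norm (g x))\<^sup>2
       + (\<delta> + sqrt \<delta>) * \<bar>f x\<bar> powr (1 + p)" for x
  have WZ: "W x \<le> Z x" for x
  proof (cases "0 < v x")
    case False
    then show ?thesis using \<delta> by (simp add: W_def Z_def max_def)
  next
    case True
    define e where "e = sqrt \<delta>"
    have e: "0 < e" "e\<^sup>2 = \<delta>" using \<delta> by (simp_all add: e_def)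
    define U where "U = u x powr (a - 1)"
    have dx: "\<delta> * (norm x)\<^sup>2 \<le> u x" "v x \<le> u x" using True \<delta> by (simp_all add: v_def)
    have U1: "U \<le> \<bar>f x\<bar> powr (2 * p)"
      using powr_mono2[of "a - 1" "u x" "\<bar>f x\<bar> powr (1 - p)"] ub[of x] a by (simp add: U_def powr_powr)
    have U2: "U * (k x)\<^sup>2 \<le> (1 - p)\<^sup>2"
      using reg_powr_deriv_bound[OF p \<delta>, of "f x"] by (simp add: U_def k_def u_def a_def)
    have U3: "U * (\<delta> * (norm x)\<^sup>2) \<le> \<bar>f x\<bar> powr (1 + p)"
    proof -
      have "U * (\<delta> * (norm x)\<^sup>2) \<le> U * u x" using dx by (intro mult_left_mono) (auto simp: U_def)
      also have "\<dots> = u x powr (a - 1 + 1)" unfolding U_def powr_add using True dx by simp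
      also have "\<dots> = u x powr a" by simp
      also have "\<dots> \<le> (\<bar>f x\<bar> powr (1 - p)) powr a" using ub[of x] a by (intro powr_mono2) auto
      also have "\<dots> = \<bar>f x\<bar> powr (1 + p)" using a by (simp add: powr_powr)
      finally show ?thesis .
    qed
    have G: "(norm (G x))\<^sup>2 \<le> (1 + e) * ((k x)\<^sup>2 * (norm (g x))\<^sup>2) + (1 + 1 / e) * (4 * \<delta> * (\<delta> * (norm x)\<^sup>2))"
      using norm_diff_power2_le[OF e(1), of "k x *\<^sub>R g x" "(2 * \<delta>) *\<^sub>R x"] \<delta>
      by (simp add: G_def power_mult_distrib power2_eq_square[of \<delta>] mult_ac)
    have "W x \<le> U * (1 + (norm (G x))\<^sup>2 / 4)"
      unfolding W_def U_def using True dx a by (intro mult_right_mono powr_mono2) auto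
    also have "\<dots> \<le> U * (1 + ((1 + e) * ((k x)\<^sup>2 * (norm (g x))\<^sup>2) + (1 + 1 / e) * (4 * \<delta> * (\<delta> * (norm x)\<^sup>2))) / 4)"
      using G by (intro mult_left_mono) (auto simp: U_def)
    also have "\<dots> = U + (1 + e) / 4 * (norm (g x))\<^sup>2 * (U * (k x)\<^sup>2) + (1 + 1 / e) * \<delta> * (U * (\<delta> * (norm x)\<^sup>2))"
      by (simp add: algebra_simps add_divide_distrib)
    also have "\<dots> \<le> \<bar>f x\<bar> powr (2 * p) + (1 + e) / 4 * (norm (g x))\<^sup>2 * (1 - p)\<^sup>2 + (1 + 1 / e) * \<delta> * \<bar>f x\<bar> powr (1 + p)"
      using U1 U2 U3 e \<delta> by (intro add_mono mult_left_mono) auto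
    also have "(1 + 1 / e) * \<delta> = \<delta> + sqrt \<delta>"
      using e by (simp add: e_def[symmetric] field_simps power2_eq_square flip: e(2))
    finally show ?thesis by (simp add: Z_def e_def mult_ac)
  qed
  have intZ: "set_integrable lborel S Z" unfolding Z_def
    using X Y A by (intro set_integral_add set_integrable_mult_right) auto
  have ZR: "(LINT x:S|lborel. Z x) = ?R"
    unfolding Z_def using X Y A by (simp add: set_integral_add)
  have Wpos: "0 \<le> W x" for x by (simp add: W_def)
  have "set_integrable lborel S W"
  proof (rule set_integrable_bound[OF intZ])
    have "continuous_on S W" unfolding W_def using a
      by (auto intro!: continuous_on_mult continuous_on_pos_part_powr vS continuous_intros GS)
    then show "set_borel_measurable lborel S W"
      unfolding set_borel_measurable_def measurable_lborel2
      by (intro borel_measurable_continuous_on_indicator borel_closed S)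
    show "AE x in lborel. x \<in> S \<longrightarrow> norm (W x) \<le> norm (Z x)"
      using WZ Wpos by (intro AE_I2) (auto intro: order_trans[OF _ abs_ge_self])
  qed
  then have WR: "(LINT x:S|lborel. W x) \<le> ?R"
    using WZ intZ unfolding ZR[symmetric] by (intro set_integral_mono)
  have Wint: "0 \<le> (LINT x:S|lborel. W x)"
    unfolding set_lebesgue_integral_def using Wpos by (intro integral_nonneg_AE AE_I2) simp
  have "0 \<le> A'"
    unfolding A'_def set_lebesgue_integral_def by (intro integral_nonneg_AE AE_I2) simp
  then consider "A' = 0" | "0 < A'" by linarith
  then have "m * A' powr (1 - 1 / m) * B powr (1 / m) \<le> a * (LINT x:S|lborel. W x)"
  proof cases
    case 1
    then show ?thesis using Wint a by simp
  next
    case 2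
    have "m * (A' powr (1 / m)) powr (m - 1) * B powr (1 / m) \<le> a * (LINT x:S|lborel. W x)"
      unfolding W_def m_def
    proof (rule sup_convolution_first_order[OF S a(1) derv GS, where R = "1 / \<delta>"])
      show "norm x \<le> 1 / \<delta>" if "0 < v x" for x
      proof -
        have "\<delta> * (norm x)\<^sup>2 < 1 / \<delta>" using that ub(3)[of x] by (simp add: v_def)
        then have "(norm x)\<^sup>2 < (1 / \<delta>)\<^sup>2" using \<delta> by (simp add: power_divide field_simps power2_eq_square)
        then show ?thesis using \<delta> power_less_imp_less_base[of "norm x" 2 "1 / \<delta>"] by simp
      qed
      show "(A' powr (1 / (a + real DIM('a)))) powr (a + real DIM('a)) = (LINT x:S|lborel. max (v x) 0 powr a)"
        using 2 m by (simp add: A'_def powr_powr flip: m_def)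
      show "(B powr (1 / (a + real DIM('a)))) powr (a + real DIM('a)) = (LINT x:S|lborel. max (1 - (norm x)\<^sup>2) 0 powr a)"
        using B m by (simp add: B_def powr_powr flip: m_def)
    qed (use 2 B \<delta> in auto)
    moreover have "(A' powr (1 / m)) powr (m - 1) = A' powr (1 - 1 / m)"
      using m by (simp add: powr_powr diff_divide_distrib)
    ultimately show ?thesis by simp
  qed
  also have "\<dots> \<le> a * ?R" using WR a by (intro mult_left_mono) auto
  finally show ?thesis by (simp add: A'_def v_def u_def)
qed

text \<open>
  The limit \<open>\<delta> \<rightarrow> 0\<close>, with \<open>|f| powr (1 + p)\<close> dominating the integrands on the left.
\<close>
theorem GN_functional:
  fixes f :: "'a::euclidean_space \<Rightarrow> real" and p :: real
  assumes S: "closed S" "convex S" "cone S" and p: "0 < p" "p < 1"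
    and der: "\<And>x. x \<in> S \<Longrightarrow> has_gradient_within f (g x) x S"
    and g: "continuous_on S g"
    and X: "set_integrable lborel S (\<lambda>x. \<bar>f x\<bar> powr (2 * p))"
    and Y: "set_integrable lborel S (\<lambda>x. (norm (g x))\<^sup>2)"
    and A: "set_integrable lborel S (\<lambda>x. \<bar>f x\<bar> powr (1 + p))"
    and a_def: "a = (1 + p) / (1 - p)" and m_def: "m = a + real DIM('a)"
    and B_def: "B = (LINT x:S|lborel. max (1 - (norm x)\<^sup>2) 0 powr a)" and B: "0 < B"
  shows "m * (LINT x:S|lborel. \<bar>f x\<bar> powr (1 + p)) powr (1 - 1 / m) * B powr (1 / m)
    \<le> a * ((LINT x:S|lborel. \<bar>f x\<bar> powr (2 * p)) + (1 - p)\<^sup>2 / 4 * (LINT x:S|lborel. (norm (g x))\<^sup>2))"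
proof -
  define d where "d j = 1 / real (Suc j)" for j
  have d: "d \<longlonglongrightarrow> 0" "0 < d j" for j
    using LIMSEQ_inverse_real_of_nat unfolding d_def inverse_eq_divide by auto
  have sd: "(\<lambda>j. sqrt (d j)) \<longlonglongrightarrow> sqrt 0" by (intro tendsto_intros d)
  have a: "1 < a" "(1 - p) * a = 1 + p" using p by (simp_all add: a_def field_simps)
  have m: "1 < m" using a(1) by (simp add: m_def)
  have fS: "continuous_on S f" by (rule has_gradient_within_imp_continuous_on[OF der])
  have c: "continuous_on S (\<lambda>x. \<bar>f x\<bar> powr (1 + p))"
    using p by (intro continuous_on_powr' continuous_intros fS) auto
  have lim: "(\<lambda>j. LINT x:S|lborel. max (reg_powr p (d j) (f x) - d j * (norm x)\<^sup>2) 0 powr a)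
      \<longlonglongrightarrow> (LINT x:S|lborel. \<bar>f x\<bar> powr (1 + p))"
    unfolding set_lebesgue_integral_def
  proof (rule integral_dominated_convergence[OF _ _ A[unfolded set_integrable_def]])
    show "(\<lambda>x. indicator S x *\<^sub>R \<bar>f x\<bar> powr (1 + p)) \<in> borel_measurable lborel"
      unfolding measurable_lborel2 by (intro borel_measurable_continuous_on_indicator borel_closed S c)
    show "(\<lambda>x. indicator S x *\<^sub>R max (reg_powr p (d j) (f x) - d j * (norm x)\<^sup>2) 0 powr a) \<in> borel_measurable lborel" for j
    proof -
      have "continuous_on UNIV (reg_powr p (d j))"
        using has_derivative_reg_powr[OF p d(2)] by (intro DERIV_continuous_on) auto
      then have "continuous_on S (\<lambda>x. reg_powr p (d j) (f x))"
        by (rule continuous_on_compose2[OF _ fS]) auto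
      then show ?thesis unfolding measurable_lborel2 using a
        by (intro borel_measurable_continuous_on_indicator borel_closed S continuous_on_pos_part_powr continuous_intros) auto
    qed
    show "AE x in lborel. norm (indicator S x *\<^sub>R max (reg_powr p (d j) (f x) - d j * (norm x)\<^sup>2) 0 powr a)
        \<le> indicator S x *\<^sub>R \<bar>f x\<bar> powr (1 + p)" for j
    proof (rule AE_I2)
      fix x :: 'a
      have "0 \<le> d j * (norm x)\<^sup>2" using d(2)[of j] by simp
      then have "max (reg_powr p (d j) (f x) - d j * (norm x)\<^sup>2) 0 \<le> \<bar>f x\<bar> powr (1 - p)"
        using reg_powr_bounds(2)[OF p d(2), of j "f x"] powr_ge_zero[of "\<bar>f x\<bar>" "1 - p"] by linarith
      then have "max (reg_powr p (d j) (f x) - d j * (norm x)\<^sup>2) 0 powr a \<le> (\<bar>f x\<bar> powr (1 - p)) powr a"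
        using a by (intro powr_mono2) auto
      then show "norm (indicator S x *\<^sub>R max (reg_powr p (d j) (f x) - d j * (norm x)\<^sup>2) 0 powr a)
        \<le> indicator S x *\<^sub>R \<bar>f x\<bar> powr (1 + p)"
        using a by (auto simp: powr_powr split: split_indicator)
    qed
    show "AE x in lborel. (\<lambda>j. indicator S x *\<^sub>R max (reg_powr p (d j) (f x) - d j * (norm x)\<^sup>2) 0 powr a)
        \<longlonglongrightarrow> indicator S x *\<^sub>R \<bar>f x\<bar> powr (1 + p)"
    proof (rule AE_I2)
      fix x :: 'a
      have "(\<lambda>j. max (reg_powr p (d j) (f x) - d j * (norm x)\<^sup>2) 0)
          \<longlonglongrightarrow> max (\<bar>f x\<bar> powr (1 - p) - 0 * (norm x)\<^sup>2) 0"
        by (intro tendsto_intros tendsto_reg_powr p d)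
      then have "(\<lambda>j. max (reg_powr p (d j) (f x) - d j * (norm x)\<^sup>2) 0) \<longlonglongrightarrow> \<bar>f x\<bar> powr (1 - p)" by simp
      then have "(\<lambda>j. max (reg_powr p (d j) (f x) - d j * (norm x)\<^sup>2) 0 powr a) \<longlonglongrightarrow> (\<bar>f x\<bar> powr (1 - p)) powr a"
        by (rule tendsto_powr'[OF _ tendsto_const]) (use a in auto)
      then show "(\<lambda>j. indicator S x *\<^sub>R max (reg_powr p (d j) (f x) - d j * (norm x)\<^sup>2) 0 powr a)
        \<longlonglongrightarrow> indicator S x *\<^sub>R \<bar>f x\<bar> powr (1 + p)"
        using a by (intro tendsto_scaleR[OF tendsto_const]) (simp add: powr_powr)
    qed
  qed
  have "m * (LINT x:S|lborel. \<bar>f x\<bar> powr (1 + p)) powr (1 - 1 / m) * B powr (1 / m)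
    \<le> a * ((LINT x:S|lborel. \<bar>f x\<bar> powr (2 * p))
       + (1 + sqrt 0) * (1 - p)\<^sup>2 / 4 * (LINT x:S|lborel. (norm (g x))\<^sup>2)
       + (0 + sqrt 0) * (LINT x:S|lborel. \<bar>f x\<bar> powr (1 + p)))"
  proof (rule tendsto_le[OF sequentially_bot])
    show "(\<lambda>j. a * ((LINT x:S|lborel. \<bar>f x\<bar> powr (2 * p))
       + (1 + sqrt (d j)) * (1 - p)\<^sup>2 / 4 * (LINT x:S|lborel. (norm (g x))\<^sup>2)
       + (d j + sqrt (d j)) * (LINT x:S|lborel. \<bar>f x\<bar> powr (1 + p)))) \<longlonglongrightarrow>
      a * ((LINT x:S|lborel. \<bar>f x\<bar> powr (2 * p))
       + (1 + sqrt 0) * (1 - p)\<^sup>2 / 4 * (LINT x:S|lborel. (norm (g x))\<^sup>2)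
       + (0 + sqrt 0) * (LINT x:S|lborel. \<bar>f x\<bar> powr (1 + p)))"
      by (intro tendsto_intros d sd) auto
    show "(\<lambda>j. m * (LINT x:S|lborel. max (reg_powr p (d j) (f x) - d j * (norm x)\<^sup>2) 0 powr a) powr (1 - 1 / m) * B powr (1 / m))
      \<longlonglongrightarrow> m * (LINT x:S|lborel. \<bar>f x\<bar> powr (1 + p)) powr (1 - 1 / m) * B powr (1 / m)"
    proof (intro tendsto_mult tendsto_const tendsto_powr'[OF lim tendsto_const])
      have "\<forall>\<^sub>F j in sequentially. 0 \<le> (LINT x:S|lborel. max (reg_powr p (d j) (f x) - d j * (norm x)\<^sup>2) 0 powr a)"
        unfolding set_lebesgue_integral_def by (intro always_eventually allI integral_nonneg_AE AE_I2) simp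
      then show "(LINT x:S|lborel. \<bar>f x\<bar> powr (1 + p)) \<noteq> 0 \<or> 0 < 1 - 1 / m \<and>
         (\<forall>\<^sub>F j in sequentially. 0 \<le> (LINT x:S|lborel. max (reg_powr p (d j) (f x) - d j * (norm x)\<^sup>2) 0 powr a))"
        using m by simp
    qed
    show "\<forall>\<^sub>F j in sequentially. m * (LINT x:S|lborel. max (reg_powr p (d j) (f x) - d j * (norm x)\<^sup>2) 0 powr a) powr (1 - 1 / m) * B powr (1 / m)
      \<le> a * ((LINT x:S|lborel. \<bar>f x\<bar> powr (2 * p))
       + (1 + sqrt (d j)) * (1 - p)\<^sup>2 / 4 * (LINT x:S|lborel. (norm (g x))\<^sup>2)
       + (d j + sqrt (d j)) * (LINT x:S|lborel. \<bar>f x\<bar> powr (1 + p)))"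
      by (intro always_eventually allI GN_functional_regularised[OF S p d(2) der g X Y A a_def m_def B_def B])
  qed
  then show ?thesis by simp
qed

section \<open>The extremal functions\<close>

lemma set_integral_lborel_affine:
  fixes \<phi> :: "'a::euclidean_space \<Rightarrow> real" and r :: real
  assumes m: "(\<lambda>x. indicator S x *\<^sub>R \<phi> x) \<in> borel_measurable borel" and r: "0 < r"
    and inv: "\<And>x. r *\<^sub>R (x - t) \<in> S \<longleftrightarrow> x \<in> S"
  shows "set_integrable lborel S (\<lambda>x. \<phi> (r *\<^sub>R (x - t))) \<longleftrightarrow> set_integrable lborel S \<phi>"
    and "(LINT x:S|lborel. \<phi> (r *\<^sub>R (x - t))) = (LINT x:S|lborel. \<phi> x) / r ^ DIM('a)"
proof -
  define H where "H x = indicator S x *\<^sub>R \<phi> x" for x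
  have [measurable]: "H \<in> borel_measurable borel" using m unfolding H_def .
  define T where "T x = - (r *\<^sub>R t) + r *\<^sub>R x" for x
  have T: "T x = r *\<^sub>R (x - t)" for x by (simp add: T_def scaleR_diff_right)
  have HT: "H (T x) = indicator S x *\<^sub>R \<phi> (r *\<^sub>R (x - t))" for x
    using inv[of x] by (simp add: H_def T indicator_def)
  have L: "lborel = density (distr lborel borel T) (\<lambda>_. ennreal (r ^ DIM('a)))"
    using lborel_affine[of r "- (r *\<^sub>R t)"] r unfolding T_def[abs_def] by simp
  have [measurable]: "T \<in> borel_measurable borel" unfolding T_def by measurable
  have "integrable lborel H \<longleftrightarrow> integrable (density (distr lborel borel T) (\<lambda>_. ennreal (r ^ DIM('a)))) H"
    using L by simp
  also have "\<dots> \<longleftrightarrow> integrable lborel (\<lambda>x. r ^ DIM('a) *\<^sub>R H (T x))"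
    using r by (subst integrable_density) (auto simp: integrable_distr_eq)
  also have "\<dots> \<longleftrightarrow> integrable lborel (\<lambda>x. H (T x))" using r by simp
  finally show "set_integrable lborel S (\<lambda>x. \<phi> (r *\<^sub>R (x - t))) \<longleftrightarrow> set_integrable lborel S \<phi>"
    unfolding set_integrable_def HT[symmetric] H_def[symmetric] ..
  have "integral\<^sup>L lborel H = integral\<^sup>L (density (distr lborel borel T) (\<lambda>_. ennreal (r ^ DIM('a)))) H"
    using L by simp
  also have "\<dots> = integral\<^sup>L lborel (\<lambda>x. r ^ DIM('a) *\<^sub>R H (T x))"
    using r by (subst integral_density) (auto simp: integral_distr)
  also have "\<dots> = r ^ DIM('a) * integral\<^sup>L lborel (\<lambda>x. H (T x))" by simp
  finally show "(LINT x:S|lborel. \<phi> (r *\<^sub>R (x - t))) = (LINT x:S|lborel. \<phi> x) / r ^ DIM('a)"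
    unfolding set_lebesgue_integral_def HT[symmetric] H_def[symmetric] using r by simp
qed

text \<open>
  Integrating the divergence of \<open>x (1 - |x|\<^sup>2)\<^sub>+ powr a\<close> over the cone \<open>S\<close> gives equality; the inequality
  needs less. Scaling by \<open>r < 1\<close> multiplies the integral on the right by \<open>r powr (- DIM('a))\<close>, while by
  convexity it changes the integrand by at least \<open>a (1 - r\<^sup>2) |x|\<^sup>2 (1 - |x|\<^sup>2)\<^sub>+ powr (a - 1)\<close>. Dividing by
  \<open>1 - r\<close> and letting \<open>r\<close> tend to \<open>1\<close> yields the claim.
\<close>
lemma Euler_inequality_ball_power:
  fixes S :: "'a::euclidean_space set" and a :: real
  assumes S: "closed S" "cone S" and a: "1 < a"
  shows "2 * a * (LINT x:S|lborel. max (1 - (norm x)\<^sup>2) 0 powr (a - 1) * (norm x)\<^sup>2)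
    \<le> DIM('a) * (LINT x:S|lborel. max (1 - (norm x)\<^sup>2) 0 powr a)"
proof -
  define P where "P x = max (1 - (norm x)\<^sup>2) 0 powr a" for x :: 'a
  define Q where "Q x = max (1 - (norm x)\<^sup>2) 0 powr (a - 1) * (norm x)\<^sup>2" for x :: 'a
  define J K where "J = (LINT x:S|lborel. P x)" and "K = (LINT x:S|lborel. Q x)"
  have cP: "continuous_on S P" and cQ: "continuous_on S Q"
    unfolding P_def Q_def using a
    by (auto intro!: continuous_on_mult continuous_on_pos_part_powr continuous_intros)
  have iP: "set_integrable lborel S P"
    by (rule set_integrable_of_bounded_support[OF S(1) cP, of 1]) (simp add: P_def pos_part_one_minus_norm_eq_0)
  have iQ: "set_integrable lborel S Q"
    by (rule set_integrable_of_bounded_support[OF S(1) cQ, of 1]) (simp add: Q_def pos_part_one_minus_norm_eq_0)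
  have J: "0 \<le> J" unfolding J_def set_lebesgue_integral_def by (intro integral_nonneg_AE AE_I2) (simp add: P_def)
  have step: "a * (r ^ DIM('a) * (1 + r)) * K \<le> DIM('a) * J" if r: "0 < r" "r < 1" for r
  proof -
    have mP: "(\<lambda>x. indicator S x *\<^sub>R P x) \<in> borel_measurable borel"
      by (intro borel_measurable_continuous_on_indicator borel_closed S cP)
    note aff = set_integral_lborel_affine[OF mP r(1), of 0]
    have inv: "r *\<^sub>R (x - 0) \<in> S \<longleftrightarrow> x \<in> S" for x using cone_scaleR_mem_iff[OF S(2) r(1)] by simp
    have iPr: "set_integrable lborel S (\<lambda>x. P (r *\<^sub>R (x - 0)))" using aff(1)[OF inv] iP by simp
    have "J + a * (1 - r\<^sup>2) * K = (LINT x:S|lborel. P x + a * (1 - r\<^sup>2) * Q x)"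
      unfolding J_def K_def using iP iQ by (subst set_integral_add) auto
    also have "\<dots> \<le> (LINT x:S|lborel. P (r *\<^sub>R (x - 0)))"
    proof (rule set_integral_mono)
      show "set_integrable lborel S (\<lambda>x. P x + a * (1 - r\<^sup>2) * Q x)" using iP iQ by (intro set_integral_add) auto
      show "P x + a * (1 - r\<^sup>2) * Q x \<le> P (r *\<^sub>R (x - 0))" for x
        using powr_pos_part_above_tangent[of a "1 - (norm x)\<^sup>2" "1 - r\<^sup>2 * (norm x)\<^sup>2"] a
        by (simp add: P_def Q_def power_mult_distrib algebra_simps)
    qed (rule iPr)
    also have "\<dots> = J / r ^ DIM('a)" using aff(2)[OF inv] by (simp add: J_def)
    finally have "(J + a * (1 - r\<^sup>2) * K) * r ^ DIM('a) \<le> J"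
      using r by (simp add: pos_le_divide_eq)
    then have 1: "a * (1 - r\<^sup>2) * K * r ^ DIM('a) \<le> J * (1 - r ^ DIM('a))"
      by (simp add: algebra_simps)
    have "1 - DIM('a) * (1 - r) \<le> r ^ DIM('a)"
      using Bernoulli_inequality[of "r - 1" "DIM('a)"] r by (simp add: algebra_simps)
    then have "J * (1 - r ^ DIM('a)) \<le> J * (DIM('a) * (1 - r))" using J by (intro mult_left_mono) auto
    with 1 have "(1 - r) * (a * (r ^ DIM('a) * (1 + r)) * K) \<le> (1 - r) * (DIM('a) * J)"
      by (simp add: algebra_simps power2_eq_square)
    then show ?thesis using r by simp
  qed
  have "((\<lambda>r. a * (r ^ DIM('a) * (1 + r)) * K) \<longlongrightarrow> a * (1 ^ DIM('a) * (1 + 1)) * K) (at_left 1)"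
    by (intro tendsto_intros)
  moreover have "\<forall>\<^sub>F r in at_left (1::real). a * (r ^ DIM('a) * (1 + r)) * K \<le> DIM('a) * J"
    using eventually_at_left_real[OF zero_less_one] by (rule eventually_mono) (auto intro: step)
  ultimately have "a * (1 ^ DIM('a) * (1 + 1)) * K \<le> DIM('a) * J"
    by (rule tendsto_upperbound) simp
  then show ?thesis by (simp add: J_def K_def P_def Q_def mult_ac)
qed

text \<open>
  The tangent inequality at \<open>s\<close> and at \<open>t\<close> confines the difference quotient between the candidate
  derivatives at \<open>s\<close> and \<open>t\<close>, and these are continuous. This treats the kink of the positive part at
  \<open>0\<close> together with all other points.
\<close>
lemma has_derivative_pos_part_powr:
  fixes b s :: real
  assumes b: "1 < b"
  shows "((\<lambda>s. max s 0 powr b) has_real_derivative b * max s 0 powr (b - 1)) (at s)"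
proof -
  define P D where "P s = max s 0 powr b" and "D s = b * max s 0 powr (b - 1)" for s :: real
  have tan: "P r + D r * (t - r) \<le> P t" for r t
    using powr_pos_part_above_tangent[of b r t] b by (simp add: P_def D_def)
  have bound: "norm ((P t - P s) / (t - s) - D s) \<le> \<bar>D t - D s\<bar>" if "t \<noteq> s" for t
  proof -
    have eq: "(P t - P s) / (t - s) - D s = (P t - P s - D s * (t - s)) / (t - s)"
      using that by (simp add: diff_divide_distrib)
    have "0 \<le> P t - P s - D s * (t - s)" "P t - P s - D s * (t - s) \<le> (D t - D s) * (t - s)"
      using tan[of s t] tan[of t s] by (simp_all add: algebra_simps)
    then have "\<bar>P t - P s - D s * (t - s)\<bar> \<le> \<bar>D t - D s\<bar> * \<bar>t - s\<bar>"
      by (simp add: abs_mult[symmetric])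
    then show ?thesis unfolding eq using that by (simp add: abs_divide pos_divide_le_eq)
  qed
  have "isCont D s" unfolding D_def
    using continuous_on_pos_part_powr[of UNIV "\<lambda>s. s" "b - 1"] b
    by (intro continuous_intros) (auto simp: continuous_on_eq_continuous_at)
  then have "((\<lambda>t. \<bar>D t - D s\<bar>) \<longlongrightarrow> 0) (at s)"
    unfolding isCont_def by (intro tendsto_rabs_zero LIM_zero)
  then have "((\<lambda>t. (P t - P s) / (t - s) - D s) \<longlongrightarrow> 0) (at s)"
    by (rule Lim_null_comparison[rotated])
       (rule eventually_mono[OF eventually_neq_at_within bound])
  then show ?thesis
    unfolding has_field_derivative_iff P_def D_def by (rule LIM_zero_cancel)
qed

definition extremal_gradient :: "real \<Rightarrow> 'a::euclidean_space \<Rightarrow> 'a"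
  where "extremal_gradient p x = (- (2 / (1 - p)) * max (1 - (norm x)\<^sup>2) 0 powr (p / (1 - p))) *\<^sub>R x"

lemma has_derivative_extremal:
  fixes x :: "'a::euclidean_space"
  assumes p: "0 < p" "p < 1"
  shows "(extremal p has_derivative (\<lambda>h. extremal_gradient p x \<bullet> h)) (at x)"
proof -
  have b: "1 < 1 / (1 - p)" "1 / (1 - p) - 1 = p / (1 - p)" using p by (simp_all add: field_simps)
  have "((\<lambda>x::'a. 1 - (norm x)\<^sup>2) has_derivative (\<lambda>h. - (2 * (x \<bullet> h)))) (at x)"
    unfolding power2_norm_eq_inner by (auto intro!: derivative_eq_intros simp: inner_commute)
  from has_derivative_compose[OF this
      has_derivative_pos_part_powr[OF b(1), of "1 - (norm x)\<^sup>2", unfolded has_field_derivative_def]]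
  have "(extremal p has_derivative (\<lambda>h. 1 / (1 - p) * max (1 - (norm x)\<^sup>2) 0 powr (p / (1 - p)) * - (2 * (x \<bullet> h)))) (at x)"
    unfolding b(2) extremal_def .
  moreover have "(\<lambda>h. 1 / (1 - p) * max (1 - (norm x)\<^sup>2) 0 powr (p / (1 - p)) * - (2 * (x \<bullet> h)))
     = (\<lambda>h. extremal_gradient p x \<bullet> h)"
    by (simp add: fun_eq_iff extremal_gradient_def)
  ultimately show ?thesis by simp
qed

lemma has_gradient_scaled_extremal:
  fixes t :: "'a::euclidean_space" and c r :: real
  assumes p: "0 < p" "p < 1"
  shows "has_gradient_within (\<lambda>x. c * extremal p (r *\<^sub>R (x - t))) ((c * r) *\<^sub>R extremal_gradient p (r *\<^sub>R (x - t))) x S"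
proof -
  have "((\<lambda>x. r *\<^sub>R (x - t)) has_derivative (\<lambda>h. r *\<^sub>R h)) (at x within S)"
    by (auto intro!: derivative_eq_intros)
  from has_derivative_compose[OF this has_derivative_extremal[OF p]]
  have "((\<lambda>x. c * extremal p (r *\<^sub>R (x - t))) has_derivative
      (\<lambda>h. c * (extremal_gradient p (r *\<^sub>R (x - t)) \<bullet> (r *\<^sub>R h)))) (at x within S)"
    by (rule has_derivative_mult_right)
  moreover have "(\<lambda>h. c * (extremal_gradient p (r *\<^sub>R (x - t)) \<bullet> (r *\<^sub>R h)))
      = (\<lambda>h. ((c * r) *\<^sub>R extremal_gradient p (r *\<^sub>R (x - t))) \<bullet> h)"
    by (simp add: fun_eq_iff)
  ultimately show ?thesis unfolding has_gradient_within_def by (simp only:)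
qed

lemma continuous_on_extremal:
  fixes p :: real assumes "0 < p" "p < 1"
  shows "continuous_on S (extremal p :: 'a::euclidean_space \<Rightarrow> real)" "continuous_on S (extremal_gradient p :: 'a \<Rightarrow> 'a)"
  unfolding extremal_def[abs_def] extremal_gradient_def[abs_def] using assms
  by (auto intro!: continuous_on_scaleR continuous_on_mult continuous_on_pos_part_powr continuous_intros)

lemma extremal_powers:
  fixes p :: real and x :: "'a::euclidean_space"
  assumes p: "0 < p" "p < 1" and a: "a = (1 + p) / (1 - p)"
  shows "\<bar>extremal p x\<bar> powr (2 * p) = max (1 - (norm x)\<^sup>2) 0 powr (a - 1)"
    and "\<bar>extremal p x\<bar> powr (1 + p) = max (1 - (norm x)\<^sup>2) 0 powr a"
    and "(norm (extremal_gradient p x))\<^sup>2 = 4 / (1 - p)\<^sup>2 * (max (1 - (norm x)\<^sup>2) 0 powr (a - 1) * (norm x)\<^sup>2)"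
proof -
  have e: "a - 1 = 2 * p / (1 - p)" using p by (simp add: a field_simps)
  show "\<bar>extremal p x\<bar> powr (2 * p) = max (1 - (norm x)\<^sup>2) 0 powr (a - 1)"
    unfolding e by (simp add: extremal_def powr_powr)
  show "\<bar>extremal p x\<bar> powr (1 + p) = max (1 - (norm x)\<^sup>2) 0 powr a"
    unfolding a by (simp add: extremal_def powr_powr)
  define M where "M = max (1 - (norm x)\<^sup>2) 0"
  have "(M powr (p / (1 - p)))\<^sup>2 = M powr (a - 1)"
    unfolding e power2_eq_square powr_add[symmetric] by (simp flip: add_divide_distrib)
  then show "(norm (extremal_gradient p x))\<^sup>2 = 4 / (1 - p)\<^sup>2 * (max (1 - (norm x)\<^sup>2) 0 powr (a - 1) * (norm x)\<^sup>2)"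
    unfolding extremal_gradient_def M_def[symmetric]
    by (simp add: power_mult_distrib power_divide)
qed

text \<open>
  With \<open>w = (1 - |x|\<^sup>2)\<^sub>+\<close>, the two terms on the left are multiples of the integrals of \<open>w powr (a - 1)\<close> and
  \<open>w powr (a - 1) |x|\<^sup>2\<close>, whose difference is the integral of \<open>w powr a\<close>; the Euler inequality bounds the
  second one. Together with \<open>GN_functional\<close>, where \<open>B\<close> is the integral on the right, this says that the
  extremal function turns the inequality into an equality.
\<close>
lemma extremal_saturates_GN_functional:
  fixes S :: "'a::euclidean_space set" and p :: real
  assumes S: "closed S" "cone S" and p: "0 < p" "p < 1"
    and a_def: "a = (1 + p) / (1 - p)"
  shows "set_integrable lborel S (\<lambda>x. \<bar>extremal p x\<bar> powr (2 * p))"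
    and "set_integrable lborel S (\<lambda>x. \<bar>extremal p x\<bar> powr (1 + p))"
    and "set_integrable lborel S (\<lambda>x. (norm (extremal_gradient p x))\<^sup>2)"
    and "a * ((LINT x:S|lborel. \<bar>extremal p x\<bar> powr (2 * p))
        + (1 - p)\<^sup>2 / 4 * (LINT x:S|lborel. (norm (extremal_gradient p x))\<^sup>2))
      \<le> (a + DIM('a)) * (LINT x:S|lborel. \<bar>extremal p x\<bar> powr (1 + p))"
proof -
  define w where "w x = max (1 - (norm x)\<^sup>2) 0" for x :: 'a
  have a: "1 < a" using p by (simp add: a_def field_simps)
  have wc: "continuous_on S (\<lambda>x. w x powr q)" if "0 < q" for q
    unfolding w_def using that by (intro continuous_on_pos_part_powr continuous_intros) auto
  have w0: "w x = 0" if "1 < norm x" for x using that by (simp add: w_def pos_part_one_minus_norm_eq_0)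
  have i1: "set_integrable lborel S (\<lambda>x. w x powr (a - 1))"
    by (rule set_integrable_of_bounded_support[OF S(1) wc, of _ 1]) (use a w0 in auto)
  have i2: "set_integrable lborel S (\<lambda>x. w x powr a)"
    by (rule set_integrable_of_bounded_support[OF S(1) wc, of _ 1]) (use a w0 in auto)
  have i3: "set_integrable lborel S (\<lambda>x. w x powr (a - 1) * (norm x)\<^sup>2)"
    by (rule set_integrable_of_bounded_support[OF S(1), of _ 1])
       (use a w0 in \<open>auto intro!: continuous_on_mult wc continuous_intros\<close>)
  have eqs: "\<bar>extremal p x\<bar> powr (2 * p) = w x powr (a - 1)" "\<bar>extremal p x\<bar> powr (1 + p) = w x powr a"
    "(norm (extremal_gradient p x))\<^sup>2 = 4 / (1 - p)\<^sup>2 * (w x powr (a - 1) * (norm x)\<^sup>2)" for x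
    using extremal_powers[OF p a_def, of x] by (simp_all add: w_def)
  show "set_integrable lborel S (\<lambda>x. \<bar>extremal p x\<bar> powr (2 * p))"
    "set_integrable lborel S (\<lambda>x. \<bar>extremal p x\<bar> powr (1 + p))"
    "set_integrable lborel S (\<lambda>x. (norm (extremal_gradient p x))\<^sup>2)"
    unfolding eqs using i1 i2 i3 by auto
  define X J K where "X = (LINT x:S|lborel. w x powr (a - 1))" and "J = (LINT x:S|lborel. w x powr a)"
    and "K = (LINT x:S|lborel. w x powr (a - 1) * (norm x)\<^sup>2)"
  have "J = (LINT x:S|lborel. w x powr (a - 1) - w x powr (a - 1) * (norm x)\<^sup>2)"
    unfolding J_def
  proof (rule arg_cong[where f = "set_lebesgue_integral lborel S"], rule ext)
    fix x
    have "w x powr a = w x powr (a - 1) * w x"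
    proof (cases "w x = 0")
      case False
      then have "w x powr (a - 1 + 1) = w x powr (a - 1) * w x" unfolding powr_add by (simp add: w_def)
      then show ?thesis by simp
    qed simp
    also have "\<dots> = w x powr (a - 1) * (1 - (norm x)\<^sup>2)" by (auto simp: w_def max_def)
    finally show "w x powr a = w x powr (a - 1) - w x powr (a - 1) * (norm x)\<^sup>2" by (simp add: algebra_simps)
  qed
  also have "\<dots> = X - K" unfolding X_def K_def using i1 i3 by (rule set_integral_diff)
  finally have X: "X = J + K" by simp
  have "2 * a * K \<le> DIM('a) * J"
    using Euler_inequality_ball_power[OF S a] by (simp add: K_def J_def w_def)
  then have "a * (X + K) \<le> (a + DIM('a)) * J" unfolding X by (simp add: algebra_simps)
  moreover have "(1 - p)\<^sup>2 / 4 * (LINT x:S|lborel. (norm (extremal_gradient p x))\<^sup>2) = K"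
    unfolding eqs K_def using p by simp
  ultimately show "a * ((LINT x:S|lborel. \<bar>extremal p x\<bar> powr (2 * p))
        + (1 - p)\<^sup>2 / 4 * (LINT x:S|lborel. (norm (extremal_gradient p x))\<^sup>2))
      \<le> (a + DIM('a)) * (LINT x:S|lborel. \<bar>extremal p x\<bar> powr (1 + p))"
    unfolding eqs X_def J_def by simp
qed

section \<open>Optimisation over multiples of the function\<close>

text \<open>
  The third claim relates \<open>\<theta>\<close> to the exponents of the additive inequality; the last one is the
  invariance of the multiplicative inequality under dilation of the argument.
\<close>
lemma GN_exponent:
  fixes p \<theta> :: real
  assumes p: "0 < p" "p < 1" and n: "0 < n" and m: "m = (1 + p) / (1 - p) + n"
    and \<theta>: "\<theta> = n * (1 - p) / ((1 + p) * (n * (1 - p) + 2 * p))"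
  shows "0 < \<theta>" "\<theta> < 1"
    and "1 / ((1 - 1 / m) * (1 + p)) = (1 - \<theta> * (1 - p)) / (2 * p)"
    and "- (n / (1 + p)) = (2 - n) * \<theta> / 2 - n * (1 - \<theta>) / (2 * p)"
proof -
  define N where "N = n * (1 - p)"
  have N: "0 < N" using n p by (simp add: N_def)
  have \<theta>N: "\<theta> = N / ((1 + p) * (N + 2 * p))" by (simp add: \<theta> N_def)
  show "0 < \<theta>" unfolding \<theta>N using N p by simp
  have "1 * N < (1 + p) * (N + 2 * p)" using N p by (intro mult_strict_mono) auto
  then show "\<theta> < 1" unfolding \<theta>N using N p by simp
  have mN: "m = (N + 1 + p) / (1 - p)" using p by (simp add: m N_def field_simps)
  have "1 - 1 / m = (N + 2 * p) / (N + 1 + p)" unfolding mN using N p by (simp add: field_simps)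
  then have "1 / ((1 - 1 / m) * (1 + p)) = (N + 1 + p) / ((N + 2 * p) * (1 + p))" by simp
  also have "\<dots> = (1 - \<theta> * (1 - p)) / (2 * p)"
  proof -
    have "(N + 2 * p) \<noteq> 0" "1 + p \<noteq> 0" "p \<noteq> 0" using N p by auto
    then show ?thesis unfolding \<theta>N by (simp add: divide_simps) (simp add: algebra_simps)
  qed
  finally show "1 / ((1 - 1 / m) * (1 + p)) = (1 - \<theta> * (1 - p)) / (2 * p)" .
  have "\<theta> * (N + 2 * p) * (1 + p) = N" unfolding \<theta>N using N p by simp
  then have "(\<theta> * (n * (1 - p) + 2 * p) * (1 + p) - n * (1 - p)) / (2 * p * (1 + p)) = 0" by (simp add: N_def)
  then show "- (n / (1 + p)) = (2 - n) * \<theta> / 2 - n * (1 - \<theta>) / (2 * p)"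
    using p by (simp add: divide_simps) (simp add: algebra_simps)
qed

text \<open>
  The value of the constant at which a function with \<open>\<integral> |f| powr (1 + p) = J\<close>,
  \<open>\<integral> |f| powr (2 p) = X\<close> and \<open>\<integral> |\<nabla>f|\<^sup>2 = Y\<close> gives equality.
\<close>
definition GN_quotient :: "real \<Rightarrow> real \<Rightarrow> real \<Rightarrow> real \<Rightarrow> real \<Rightarrow> real"
  where "GN_quotient p \<theta> J X Y
    = J powr (1 / (p + 1)) / ((Y powr (1 / 2)) powr \<theta> * (X powr (1 / (2 * p))) powr (1 - \<theta>))"

text \<open>
  Here \<open>J\<^sub>0\<close>, \<open>X\<^sub>0\<close>, \<open>Y\<^sub>0\<close> are the integrals of the extremal function. The additive inequality for all
  multiples \<open>\<mu> f\<close> is used only for the one \<open>\<mu>\<close> with \<open>\<mu>\<^sup>2 Y = s Y\<^sub>0\<close> and \<open>\<mu> powr (2 p) X = s X\<^sub>0\<close> for a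
  common factor \<open>s\<close>; there it can be compared with the extremal case, so that minimising over \<open>\<mu>\<close>
  is not necessary.
\<close>
lemma GN_optimise_pos:
  fixes p \<theta> :: real
  assumes p: "0 < p" "p < 1" and n: "0 < n" and m: "m = (1 + p) / (1 - p) + n"
    and \<theta>: "\<theta> = n * (1 - p) / ((1 + p) * (n * (1 - p) + 2 * p))"
    and pos: "0 < J\<^sub>0" "0 < X\<^sub>0" "0 < Y\<^sub>0" and ext: "a * (X\<^sub>0 + c * Y\<^sub>0) \<le> m * J\<^sub>0"
    and XY: "0 < X" "0 < Y" and A: "0 \<le> A" "0 \<le> a"
    and ineq: "\<And>\<mu>. 0 < \<mu> \<Longrightarrow> m * (\<mu> powr (1 + p) * A) powr (1 - 1 / m) * J\<^sub>0 powr (1 / m)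
       \<le> a * (\<mu> powr (2 * p) * X + c * (\<mu> powr 2 * Y))"
  shows "A powr (1 / (p + 1)) \<le> GN_quotient p \<theta> J\<^sub>0 X\<^sub>0 Y\<^sub>0
     * (Y powr (1 / 2)) powr \<theta> * (X powr (1 / (2 * p))) powr (1 - \<theta>)"
proof -
  note exps = GN_exponent[OF p n m \<theta>]
  have "1 < (1 + p) / (1 - p)" using p by simp
  then have m1: "1 < m" using n by (simp add: m)
  define x y where "x = X / X\<^sub>0" and "y = Y / Y\<^sub>0"
  have xy: "0 < x" "0 < y" "X = x * X\<^sub>0" "Y = y * Y\<^sub>0" using XY pos by (simp_all add: x_def y_def)
  define \<mu> where "\<mu> = (x / y) powr (1 / (2 - 2 * p))"
  have \<mu>: "0 < \<mu>" using xy by (simp add: \<mu>_def)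
  define \<sigma> where "\<sigma> = 1 - 1 / m"
  have \<sigma>: "0 < \<sigma>" using m1 by (simp add: \<sigma>_def)
  define s where "s = \<mu> powr (2 * p) * x"
  have s: "0 < s" using \<mu> xy by (simp add: s_def)
  \<comment> \<open>The choice of \<open>\<mu>\<close> makes the two terms on the right proportional to the extremal ones.\<close>
  have "\<mu> powr 2 = \<mu> powr (2 * p) * \<mu> powr (2 - 2 * p)" by (simp flip: powr_add)
  also have "\<mu> powr (2 - 2 * p) = x / y" using p xy by (simp add: \<mu>_def powr_powr)
  finally have sy: "\<mu> powr 2 * Y = s * Y\<^sub>0" using xy by (simp add: s_def)
  have sx: "\<mu> powr (2 * p) * X = s * X\<^sub>0" using xy by (simp add: s_def)
  have "m * (\<mu> powr (1 + p) * A) powr \<sigma> * J\<^sub>0 powr (1 / m) \<le> a * (s * X\<^sub>0 + c * (s * Y\<^sub>0))"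
    using ineq[OF \<mu>] unfolding sx sy \<sigma>_def .
  also have "\<dots> = s * (a * (X\<^sub>0 + c * Y\<^sub>0))" by (simp add: algebra_simps)
  also have "\<dots> \<le> s * (m * J\<^sub>0)" using s ext by (intro mult_left_mono) auto
  also have "s * (m * J\<^sub>0) = s * (m * (J\<^sub>0 powr \<sigma> * J\<^sub>0 powr (1 / m)))"
    using pos by (simp add: \<sigma>_def flip: powr_add)
  finally have "(m * J\<^sub>0 powr (1 / m)) * (\<mu> powr (1 + p) * A) powr \<sigma> \<le> (m * J\<^sub>0 powr (1 / m)) * (s * J\<^sub>0 powr \<sigma>)"
    by (simp add: mult_ac)
  then have "(\<mu> powr (1 + p) * A) powr \<sigma> \<le> s * J\<^sub>0 powr \<sigma>"
    by (rule mult_left_le_imp_le) (use m1 pos in simp)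
  then have "((\<mu> powr (1 + p) * A) powr \<sigma>) powr (1 / (\<sigma> * (1 + p))) \<le> (s * J\<^sub>0 powr \<sigma>) powr (1 / (\<sigma> * (1 + p)))"
    using \<sigma> p by (intro powr_mono2) auto
  then have le: "\<mu> * A powr (1 / (1 + p)) \<le> s powr (1 / (\<sigma> * (1 + p))) * J\<^sub>0 powr (1 / (1 + p))"
    using \<sigma> p \<mu> A s pos by (simp add: powr_mult powr_powr)
  define \<tau> where "\<tau> = 1 / (\<sigma> * (1 + p))"
  have \<tau>: "\<tau> = (1 - \<theta> * (1 - p)) / (2 * p)" using exps(3) by (simp add: \<tau>_def \<sigma>_def)
  have e1: "2 * p * \<tau> - 1 = - (\<theta> / 2) * (2 - 2 * p)" using p by (simp add: \<tau> field_simps)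
  have e2: "\<tau> - \<theta> / 2 = (1 - \<theta>) / (2 * p)" using p by (simp add: \<tau> field_simps)
  have "s powr \<tau> / \<mu> = \<mu> powr (2 * p * \<tau>) * x powr \<tau> / \<mu> powr 1"
    using \<mu> xy by (simp add: s_def powr_mult powr_powr)
  also have "\<dots> = \<mu> powr (2 * p * \<tau> - 1) * x powr \<tau>" by (simp add: powr_diff)
  also have "\<mu> powr (2 * p * \<tau> - 1) = (x / y) powr (- (\<theta> / 2))"
    unfolding e1 \<mu>_def powr_powr using p by simp
  also have "(x / y) powr (- (\<theta> / 2)) * x powr \<tau> = x powr (\<tau> - \<theta> / 2) * y powr (\<theta> / 2)"
  proof -
    have "(x / y) powr (- (\<theta> / 2)) = x powr (- (\<theta> / 2)) * y powr (\<theta> / 2)"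
      using xy by (simp add: powr_minus powr_divide divide_simps)
    moreover have "x powr (- (\<theta> / 2)) * x powr \<tau> = x powr (\<tau> - \<theta> / 2)"
      unfolding powr_add[symmetric] by simp
    ultimately show ?thesis by (simp add: mult_ac)
  qed
  finally have fac: "s powr \<tau> / \<mu> = x powr ((1 - \<theta>) / (2 * p)) * y powr (\<theta> / 2)" unfolding e2 .
  have "A powr (1 / (1 + p)) \<le> s powr \<tau> / \<mu> * J\<^sub>0 powr (1 / (1 + p))"
    using le \<mu> by (simp add: \<tau>_def field_simps)
  also have "\<dots> = GN_quotient p \<theta> J\<^sub>0 X\<^sub>0 Y\<^sub>0 * (Y powr (1 / 2)) powr \<theta> * (X powr (1 / (2 * p))) powr (1 - \<theta>)"
    unfolding fac GN_quotient_def powr_powr x_def y_def using XY pos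
    by (simp add: powr_divide add.commute[of p 1] mult_ac)
  finally show ?thesis by (simp add: add.commute)
qed

text \<open>
  The degenerate cases \<open>X = 0\<close> and \<open>Y = 0\<close> follow by continuity, from \<open>X + e\<close> and \<open>Y + e\<close> for small
  positive \<open>e\<close>; the exponents on the right are positive.
\<close>
lemma GN_optimise:
  fixes p \<theta> :: real
  assumes p: "0 < p" "p < 1" and n: "0 < n" and m: "m = (1 + p) / (1 - p) + n"
    and \<theta>: "\<theta> = n * (1 - p) / ((1 + p) * (n * (1 - p) + 2 * p))"
    and pos: "0 < J\<^sub>0" "0 < X\<^sub>0" "0 < Y\<^sub>0" and ext: "a * (X\<^sub>0 + c * Y\<^sub>0) \<le> m * J\<^sub>0"
    and XY: "0 \<le> X" "0 \<le> Y" and A: "0 \<le> A" "0 \<le> a" "0 \<le> c"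
    and ineq: "\<And>\<mu>. 0 < \<mu> \<Longrightarrow> m * (\<mu> powr (1 + p) * A) powr (1 - 1 / m) * J\<^sub>0 powr (1 / m)
       \<le> a * (\<mu> powr (2 * p) * X + c * (\<mu> powr 2 * Y))"
  shows "A powr (1 / (p + 1)) \<le> GN_quotient p \<theta> J\<^sub>0 X\<^sub>0 Y\<^sub>0
     * (Y powr (1 / 2)) powr \<theta> * (X powr (1 / (2 * p))) powr (1 - \<theta>)"
proof -
  note exps = GN_exponent[OF p n m \<theta>]
  have le: "A powr (1 / (p + 1)) \<le> GN_quotient p \<theta> J\<^sub>0 X\<^sub>0 Y\<^sub>0
     * ((Y + e) powr (1 / 2)) powr \<theta> * ((X + e) powr (1 / (2 * p))) powr (1 - \<theta>)" if e: "0 < e" for e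
  proof (rule GN_optimise_pos[OF p n m \<theta> pos ext _ _ A(1,2)])
    fix \<mu> :: real assume \<mu>: "0 < \<mu>"
    have "a * (\<mu> powr (2 * p) * X + c * (\<mu> powr 2 * Y)) \<le> a * (\<mu> powr (2 * p) * (X + e) + c * (\<mu> powr 2 * (Y + e)))"
      using e A by (intro mult_left_mono add_mono) auto
    with ineq[OF \<mu>] show "m * (\<mu> powr (1 + p) * A) powr (1 - 1 / m) * J\<^sub>0 powr (1 / m)
       \<le> a * (\<mu> powr (2 * p) * (X + e) + c * (\<mu> powr 2 * (Y + e)))" by linarith
  qed (use e XY in auto)
  have t: "((\<lambda>e. ((Z + e) powr r) powr s) \<longlongrightarrow> ((Z + 0) powr r) powr s) (at_right 0)"
    if "0 \<le> Z" "0 < r" "0 < s" for Z r s :: real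
  proof -
    have "((\<lambda>e. (Z + e) powr (r * s)) \<longlongrightarrow> (Z + 0) powr (r * s)) (at_right 0)"
    proof (rule tendsto_powr'[OF _ tendsto_const])
      have "\<forall>\<^sub>F e in at_right 0. 0 \<le> Z + e"
        using that by (auto intro!: eventually_at_rightI[of 0 1])
      then show "Z + 0 \<noteq> 0 \<or> 0 < r * s \<and> (\<forall>\<^sub>F e in at_right 0. 0 \<le> Z + e)" using that by simp
    qed (intro tendsto_intros)
    then show ?thesis by (simp add: powr_powr)
  qed
  have "((\<lambda>e. GN_quotient p \<theta> J\<^sub>0 X\<^sub>0 Y\<^sub>0 * ((Y + e) powr (1 / 2)) powr \<theta> * ((X + e) powr (1 / (2 * p))) powr (1 - \<theta>))
    \<longlongrightarrow> GN_quotient p \<theta> J\<^sub>0 X\<^sub>0 Y\<^sub>0 * ((Y + 0) powr (1 / 2)) powr \<theta> * ((X + 0) powr (1 / (2 * p))) powr (1 - \<theta>)) (at_right 0)"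
    using exps XY p by (intro tendsto_mult tendsto_const t) auto
  moreover have "\<forall>\<^sub>F e in at_right 0. A powr (1 / (p + 1)) \<le> GN_quotient p \<theta> J\<^sub>0 X\<^sub>0 Y\<^sub>0
     * ((Y + e) powr (1 / 2)) powr \<theta> * ((X + e) powr (1 / (2 * p))) powr (1 - \<theta>)"
    using le by (auto intro!: eventually_at_rightI[of 0 1])
  ultimately have "A powr (1 / (p + 1)) \<le> GN_quotient p \<theta> J\<^sub>0 X\<^sub>0 Y\<^sub>0
     * ((Y + 0) powr (1 / 2)) powr \<theta> * ((X + 0) powr (1 / (2 * p))) powr (1 - \<theta>)"
    by (rule tendsto_lowerbound) simp
  then show ?thesis by simp
qed

text \<open>
  The integrals of \<open>c f (r (x - t))\<close> are those of \<open>f\<close>, multiplied by powers of \<open>c\<close> and \<open>r\<close>; these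
  cancel in the quotient.
\<close>
lemma GN_quotient_scaling:
  fixes p \<theta> :: real
  assumes p: "0 < p" "p < 1" and n: "0 < n"
    and \<theta>: "\<theta> = n * (1 - p) / ((1 + p) * (n * (1 - p) + 2 * p))"
    and pos: "0 < J" "0 < X" "0 < Y" "0 < c" "0 < r"
  shows "(c powr (p + 1) * J / r powr n) powr (1 / (p + 1)) = GN_quotient p \<theta> J X Y
     * (((c * r) powr 2 * Y / r powr n) powr (1 / 2)) powr \<theta>
     * ((c powr (2 * p) * X / r powr n) powr (1 / (2 * p))) powr (1 - \<theta>)"
proof -
  note e = GN_exponent(4)[OF p n refl \<theta>]
  have "(((c * r) powr 2 * Y / r powr n) powr (1 / 2)) powr \<theta>
      = c powr \<theta> * r powr ((2 - n) * \<theta> / 2) * (Y powr (1 / 2)) powr \<theta>"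
  proof -
    have "(c * r) powr 2 * Y / r powr n = c powr 2 * r powr (2 - n) * Y"
      unfolding powr_diff using pos by (simp add: power_mult_distrib)
    then show ?thesis using pos by (simp only: powr_powr powr_mult powr_ge_zero mult_nonneg_nonneg less_imp_le) simp
  qed
  moreover have "((c powr (2 * p) * X / r powr n) powr (1 / (2 * p))) powr (1 - \<theta>)
      = c powr (1 - \<theta>) * r powr (- (n * (1 - \<theta>) / (2 * p))) * (X powr (1 / (2 * p))) powr (1 - \<theta>)"
  proof -
    have "c powr (2 * p) * X / r powr n = c powr (2 * p) * r powr (- n) * X"
      using pos by (simp add: powr_minus divide_inverse)
    then show ?thesis using pos p by (simp add: powr_powr powr_mult)
  qed
  moreover have "(c powr (p + 1) * J / r powr n) powr (1 / (p + 1))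
      = c * r powr (- (n / (1 + p))) * J powr (1 / (p + 1))"
  proof -
    have "c powr (p + 1) * J / r powr n = c powr (p + 1) * r powr (- n) * J"
      using pos by (simp add: powr_minus divide_inverse)
    then show ?thesis using pos p by (simp add: powr_powr powr_mult add.commute)
  qed
  moreover have "c = c powr \<theta> * c powr (1 - \<theta>)" using pos by (simp flip: powr_add)
  moreover have "r powr (- (n / (1 + p))) = r powr ((2 - n) * \<theta> / 2) * r powr (- (n * (1 - \<theta>) / (2 * p)))"
    unfolding powr_add[symmetric] using e by simp
  ultimately show ?thesis
    unfolding GN_quotient_def using pos by (simp add: mult_ac)
qed

section \<open>The half space\<close>

lemma set_integral_pos_of_ball:
  fixes \<phi> :: "'a::euclidean_space \<Rightarrow> real"
  assumes int: "set_integrable lborel S \<phi>" and nn: "\<And>x. 0 \<le> \<phi> x"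
    and ball: "0 < e" "ball z e \<subseteq> S" "\<And>x. x \<in> ball z e \<Longrightarrow> 0 < \<phi> x"
  shows "0 < (LINT x:S|lborel. \<phi> x)"
proof -
  have nn': "0 \<le> indicator S x *\<^sub>R \<phi> x" for x using nn by simp
  have "(LINT x:S|lborel. \<phi> x) \<noteq> 0"
  proof
    assume "(LINT x:S|lborel. \<phi> x) = 0"
    then have "AE x in lborel. indicator S x *\<^sub>R \<phi> x = 0"
      using int nn' unfolding set_integrable_def set_lebesgue_integral_def
      by (subst (asm) integral_nonneg_eq_0_iff_AE) auto
    then have "AE x in lborel. x \<notin> ball z e"
    proof (rule AE_mp, intro AE_I2 impI notI)
      fix x assume "indicator S x *\<^sub>R \<phi> x = 0" "x \<in> ball z e"
      moreover from this ball have "x \<in> S" "0 < \<phi> x" by blast+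
      ultimately show False by simp
    qed
    then have "emeasure lborel (ball z e) = 0"
      by (subst (asm) AE_iff_measurable[OF _ refl]) (auto simp: ball_def)
    then have "measure lborel (ball z e) = 0" by (simp add: measure_def)
    then show False using content_ball_pos[OF ball(1), of z] by simp
  qed
  moreover have "0 \<le> (LINT x:S|lborel. \<phi> x)"
    unfolding set_lebesgue_integral_def using nn' by (intro integral_nonneg_AE AE_I2)
  ultimately show ?thesis by simp
qed

lemma closed_half_space: "closed (half_space k)"
  unfolding half_space_def by (intro closed_Collect_le continuous_intros)

lemma convex_half_space: "convex (half_space k)"
  unfolding half_space_def convex_def by simp

lemma cone_half_space: "cone (half_space k)"
  unfolding half_space_def cone_def by simp

text \<open>
  At every point of the half space one can move in the positive direction of each coordinate axis
  without leaving it, which makes the derivative within the half space unique.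
\<close>
lemma gradient_within_half_space_eq:
  fixes f :: "real ^ 'n \<Rightarrow> real"
  assumes x: "x \<in> half_space k" and G: "has_gradient_within f G x (half_space k)"
  shows "gradient_within (half_space k) f x = G"
  unfolding gradient_within_def
proof (rule the_equality[where P = "\<lambda>g. has_gradient_within f g x (half_space k)", OF G])
  fix g assume g: "has_gradient_within f g x (half_space k)"
  have "(\<lambda>v. g \<bullet> v) = (\<lambda>v. G \<bullet> v)"
  proof (rule frechet_derivative_unique_within)
    fix i :: "real ^ 'n" and e :: real assume "i \<in> Basis" "0 < e"
    then have "x + (e / 2) *\<^sub>R i \<in> half_space k"
      using x by (auto simp: half_space_def Basis_vec_def axis_def)
    then show "\<exists>d. 0 < \<bar>d\<bar> \<and> \<bar>d\<bar> < e \<and> x + d *\<^sub>R i \<in> half_space k"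
      using \<open>0 < e\<close> by (intro exI[of _ "e / 2"]) auto
  qed (use g G in \<open>simp_all add: has_gradient_within_def\<close>)
  then show "g = G" by (metis vector_eq_rdot)
qed

text \<open>
  The passage from the completed measure restricted to \<open>S\<close> to Borel set integrals. The function \<open>\<psi>\<close>
  is only known on \<open>S\<close>, as is the case for the norm of the gradient within \<open>S\<close>.
\<close>
lemma lebesgue_on_eq_set_integral:
  fixes \<phi> :: "'a::euclidean_space \<Rightarrow> real"
  assumes S: "closed S" and c: "continuous_on S \<phi>" and eq: "\<And>x. x \<in> S \<Longrightarrow> \<psi> x = \<phi> x"
  shows "integrable (lebesgue_on S) \<psi> \<longleftrightarrow> set_integrable lborel S \<phi>"
    and "(LINT x|lebesgue_on S. \<psi> x) = (LINT x:S|lborel. \<phi> x)"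
proof -
  have m: "(\<lambda>x. indicator S x *\<^sub>R \<phi> x) \<in> borel_measurable lborel"
    unfolding measurable_lborel2 by (intro borel_measurable_continuous_on_indicator borel_closed S c)
  have S': "S \<inter> space lebesgue \<in> sets lebesgue" using S by simp
  have e: "(\<lambda>x. indicator S x *\<^sub>R \<psi> x) = (\<lambda>x. indicator S x *\<^sub>R \<phi> x)"
    using eq by (auto simp: fun_eq_iff indicator_def)
  show "integrable (lebesgue_on S) \<psi> \<longleftrightarrow> set_integrable lborel S \<phi>"
    unfolding integrable_restrict_space[OF S'] e set_integrable_def by (rule integrable_completion[OF m])
  show "(LINT x|lebesgue_on S. \<psi> x) = (LINT x:S|lborel. \<phi> x)"
    unfolding integral_restrict_space[OF S'] e set_lebesgue_integral_def by (rule integral_completion[OF m])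
qed

lemma half_space_Lnorms:
  fixes f :: "real ^ 'n \<Rightarrow> real" and p :: real and k :: 'n
  defines "H \<equiv> half_space k"
  assumes p: "0 < p"
    and der: "\<forall>x\<in>H. has_gradient_within f (g x) x H" and g: "continuous_on H g"
  shows "GN_norms_finite p k f \<longleftrightarrow> set_integrable lborel H (\<lambda>x. \<bar>f x\<bar> powr (1 + p))
      \<and> set_integrable lborel H (\<lambda>x. (norm (g x))\<^sup>2) \<and> set_integrable lborel H (\<lambda>x. \<bar>f x\<bar> powr (2 * p))"
    and "Lnorm (lebesgue_on H) (p + 1) f = (LINT x:H|lborel. \<bar>f x\<bar> powr (1 + p)) powr (1 / (p + 1))"
    and "Lnorm (lebesgue_on H) 2 (gradient_within H f) = (LINT x:H|lborel. (norm (g x))\<^sup>2) powr (1 / 2)"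
    and "Lnorm (lebesgue_on H) (2 * p) f = (LINT x:H|lborel. \<bar>f x\<bar> powr (2 * p)) powr (1 / (2 * p))"
proof -
  have H: "closed H" unfolding H_def by (rule closed_half_space)
  have f: "continuous_on H f" using der by (intro has_gradient_within_imp_continuous_on) auto
  have c: "continuous_on H (\<lambda>x. \<bar>f x\<bar> powr (1 + p))" "continuous_on H (\<lambda>x. \<bar>f x\<bar> powr (2 * p))"
    using p by (auto intro!: continuous_on_powr' continuous_on_rabs continuous_on_const f)
  have cg: "continuous_on H (\<lambda>x. (norm (g x))\<^sup>2)" by (intro continuous_intros g)
  have grad: "norm (gradient_within H f x) powr 2 = (norm (g x))\<^sup>2" if "x \<in> H" for x
    using gradient_within_half_space_eq[of x k f "g x"] der that by (simp add: H_def)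
  have n: "norm (f x) powr (p + 1) = \<bar>f x\<bar> powr (1 + p)" "norm (f x) powr (2 * p) = \<bar>f x\<bar> powr (2 * p)" for x
    by (simp_all add: add.commute)
  show "GN_norms_finite p k f \<longleftrightarrow> set_integrable lborel H (\<lambda>x. \<bar>f x\<bar> powr (1 + p))
      \<and> set_integrable lborel H (\<lambda>x. (norm (g x))\<^sup>2) \<and> set_integrable lborel H (\<lambda>x. \<bar>f x\<bar> powr (2 * p))"
    unfolding GN_norms_finite_def finite_Lnorm_def H_def[symmetric]
    using lebesgue_on_eq_set_integral(1)[OF H c(1) n(1)] lebesgue_on_eq_set_integral(1)[OF H c(2) n(2)]
      lebesgue_on_eq_set_integral(1)[OF H cg grad] by blast
  show "Lnorm (lebesgue_on H) (p + 1) f = (LINT x:H|lborel. \<bar>f x\<bar> powr (1 + p)) powr (1 / (p + 1))"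
    unfolding Lnorm_def using lebesgue_on_eq_set_integral(2)[OF H c(1) n(1)] by simp
  show "Lnorm (lebesgue_on H) 2 (gradient_within H f) = (LINT x:H|lborel. (norm (g x))\<^sup>2) powr (1 / 2)"
    unfolding Lnorm_def using lebesgue_on_eq_set_integral(2)[OF H cg grad] by simp
  show "Lnorm (lebesgue_on H) (2 * p) f = (LINT x:H|lborel. \<bar>f x\<bar> powr (2 * p)) powr (1 / (2 * p))"
    unfolding Lnorm_def using lebesgue_on_eq_set_integral(2)[OF H c(2) n(2)] by simp
qed

lemma smooth_on_imp_continuous_gradient:
  fixes f :: "'a::euclidean_space \<Rightarrow> real"
  assumes "smooth_on S f"
  obtains g where "\<And>x. x \<in> S \<Longrightarrow> has_gradient_within f (g x) x S" "continuous_on S g"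
proof -
  have "Ck_on (Suc 0) S f" using assms unfolding smooth_on_def by blast
  then obtain g where g: "\<And>x. x \<in> S \<Longrightarrow> has_gradient_within f (g x) x S"
      "\<And>b. b \<in> Basis \<Longrightarrow> continuous_on S (\<lambda>x. g x \<bullet> b)"
    by auto
  have "continuous_on S g" using g(2) by (subst continuous_on_componentwise) auto
  with g(1) show ?thesis by (rule that)
qed

lemma half_space_extremal_positive:
  fixes k :: "'n::finite" and p :: real
  defines "H \<equiv> half_space k"
  assumes p: "0 < p" "p < 1"
  shows "0 < (LINT x:H|lborel. \<bar>extremal p x\<bar> powr (1 + p))"
    and "0 < (LINT x:H|lborel. \<bar>extremal p x\<bar> powr (2 * p))"
    and "0 < (LINT x:H|lborel. (norm (extremal_gradient p x))\<^sup>2)"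
proof -
  have H: "closed H" "cone H" unfolding H_def by (rule closed_half_space cone_half_space)+
  note int = extremal_saturates_GN_functional(1-3)[OF H p refl]
  \<comment> \<open>A ball in the half space, inside the unit ball and away from the origin, where the gradient vanishes.\<close>
  define z :: "real ^ 'n" where "z = (1 / 2) *\<^sub>R axis k 1"
  have nz: "norm z = 1 / 2" by (simp add: z_def norm_axis_1)
  have ball: "x \<in> H" "0 < norm x" "norm x < 1" if "x \<in> ball z (1 / 4)" for x
  proof -
    have d: "norm (z - x) < 1 / 4" using that by (simp add: dist_norm)
    have "\<bar>(z - x) $ k\<bar> \<le> norm (z - x)" by (rule component_le_norm_cart)
    then show "x \<in> H" using d by (simp add: H_def half_space_def z_def axis_def)
    show "0 < norm x" using d nz by auto
    have "norm x \<le> norm z + norm (x - z)" using norm_triangle_ineq[of z "x - z"] by simp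
    then show "norm x < 1" using d nz by (simp add: norm_minus_commute)
  qed
  have pos: "0 < 1 - (norm x)\<^sup>2" if "x \<in> ball z (1 / 4)" for x
    using ball[OF that] power_strict_mono[of "norm x" 1 2] by simp
  then have ext: "0 < \<bar>extremal p x\<bar>" if "x \<in> ball z (1 / 4)" for x
    using that by (force simp: extremal_def)
  have grad: "extremal_gradient p x \<noteq> 0" if "x \<in> ball z (1 / 4)" for x
    using ball(2)[OF that] pos[OF that] p by (auto simp: extremal_gradient_def max_def)
  show "0 < (LINT x:H|lborel. \<bar>extremal p x\<bar> powr (1 + p))"
    by (rule set_integral_pos_of_ball[OF int(2), of "1 / 4" z]) (use ball ext in auto)
  show "0 < (LINT x:H|lborel. \<bar>extremal p x\<bar> powr (2 * p))"
    by (rule set_integral_pos_of_ball[OF int(1), of "1 / 4" z]) (use ball ext in auto)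
  show "0 < (LINT x:H|lborel. (norm (extremal_gradient p x))\<^sup>2)"
    by (rule set_integral_pos_of_ball[OF int(3), of "1 / 4" z]) (use ball grad in auto)
qed

theorem corollary1p9:
  fixes p \<theta> :: real and k :: "'n::finite"
  assumes "0 < p" and "p < 1"
    and "\<theta> = real CARD('n) * (1 - p) / ((1 + p) * (real CARD('n) * (1 - p) + 2 * p))"
  shows "\<exists>C::real.
    (\<forall>f :: real ^ 'n \<Rightarrow> real.
       smooth_on (half_space k) f \<longrightarrow> GN_norms_finite p k f \<longrightarrow>
       Lnorm (lebesgue_on (half_space k)) (p + 1) f
         \<le> C * Lnorm (lebesgue_on (half_space k)) 2 (gradient_within (half_space k) f) powr \<theta>
             * Lnorm (lebesgue_on (half_space k)) (2 * p) f powr (1 - \<theta>)) \<and>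
    (\<forall>(c::real) (r::real) (a :: real ^ 'n) f.
       0 < r \<longrightarrow> a $ k = 0 \<longrightarrow> f = (\<lambda>x. c * extremal p (r *\<^sub>R (x - a))) \<longrightarrow>
       GN_norms_finite p k f \<and>
       Lnorm (lebesgue_on (half_space k)) (p + 1) f
         = C * Lnorm (lebesgue_on (half_space k)) 2 (gradient_within (half_space k) f) powr \<theta>
             * Lnorm (lebesgue_on (half_space k)) (2 * p) f powr (1 - \<theta>))"
proof -
  note p = assms(1,2) and \<theta> = assms(3)
  define H where "H = half_space k"
  have H: "closed H" "convex H" "cone H"
    unfolding H_def by (rule closed_half_space convex_half_space cone_half_space)+
  define n where "n = real CARD('n)"
  have n: "0 < n" "real DIM(real ^ 'n) = n" by (simp_all add: n_def)
  have \<theta>n: "\<theta> = n * (1 - p) / ((1 + p) * (n * (1 - p) + 2 * p))" using \<theta> by (simp add: n_def)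
  define a where "a = (1 + p) / (1 - p)"
  define m where "m = (1 + p) / (1 - p) + n"
  have a: "0 < a" using p by (simp add: a_def)
  define J X\<^sub>0 Y\<^sub>0 where "J = (LINT x:H|lborel. \<bar>extremal p x\<bar> powr (1 + p))"
    and "X\<^sub>0 = (LINT x:H|lborel. \<bar>extremal p x\<bar> powr (2 * p))"
    and "Y\<^sub>0 = (LINT x:H|lborel. (norm (extremal_gradient p x))\<^sup>2)"
  have pos: "0 < J" "0 < X\<^sub>0" "0 < Y\<^sub>0"
    using half_space_extremal_positive[OF p, of k] by (simp_all add: J_def X\<^sub>0_def Y\<^sub>0_def H_def)
  have ext: "a * (X\<^sub>0 + (1 - p)\<^sup>2 / 4 * Y\<^sub>0) \<le> m * J"
    using extremal_saturates_GN_functional(4)[OF H(1,3) p a_def] n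
    by (simp add: J_def X\<^sub>0_def Y\<^sub>0_def m_def a_def)
  have J_eq: "J = (LINT x:H|lborel. max (1 - (norm x)\<^sup>2) 0 powr a)"
    unfolding J_def extremal_powers(2)[OF p a_def] ..
  define C where "C = GN_quotient p \<theta> J X\<^sub>0 Y\<^sub>0"
  have ineq: "Lnorm (lebesgue_on H) (p + 1) f
      \<le> C * Lnorm (lebesgue_on H) 2 (gradient_within H f) powr \<theta> * Lnorm (lebesgue_on H) (2 * p) f powr (1 - \<theta>)"
    if smooth: "smooth_on H f" and fin: "GN_norms_finite p k f" for f
  proof -
    obtain g where der: "\<And>x. x \<in> H \<Longrightarrow> has_gradient_within f (g x) x H" and g: "continuous_on H g"
      using smooth_on_imp_continuous_gradient[OF smooth] by blast
    have "\<forall>x\<in>H. has_gradient_within f (g x) x H" using der by blast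
    note norms = half_space_Lnorms[where k = k, folded H_def, OF p(1) this g]
    have int: "set_integrable lborel H (\<lambda>x. \<bar>f x\<bar> powr (1 + p))"
      "set_integrable lborel H (\<lambda>x. (norm (g x))\<^sup>2)" "set_integrable lborel H (\<lambda>x. \<bar>f x\<bar> powr (2 * p))"
      using norms(1) fin by auto
    show ?thesis
      unfolding norms(2-4) C_def
    proof (rule GN_optimise[OF p n(1) m_def \<theta>n pos ext])
      fix \<mu> :: real assume \<mu>: "0 < \<mu>"
      have powr_\<mu>: "\<bar>\<mu> * f x\<bar> powr q = \<mu> powr q * \<bar>f x\<bar> powr q" for x q
        using \<mu> by (simp add: abs_mult powr_mult)
      have norm_\<mu>: "(norm (\<mu> *\<^sub>R g x))\<^sup>2 = \<mu> powr 2 * (norm (g x))\<^sup>2" for x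
        using \<mu> by (simp add: power_mult_distrib)
      have "m * (LINT x:H|lborel. \<bar>\<mu> * f x\<bar> powr (1 + p)) powr (1 - 1 / m) * J powr (1 / m)
        \<le> a * ((LINT x:H|lborel. \<bar>\<mu> * f x\<bar> powr (2 * p))
           + (1 - p)\<^sup>2 / 4 * (LINT x:H|lborel. (norm (\<mu> *\<^sub>R g x))\<^sup>2))"
      proof (rule GN_functional[OF H p])
        show "has_gradient_within (\<lambda>x. \<mu> * f x) (\<mu> *\<^sub>R g x) x H" if "x \<in> H" for x
        proof -
          have "(\<lambda>h. \<mu> * (g x \<bullet> h)) = (\<lambda>h. (\<mu> *\<^sub>R g x) \<bullet> h)" by (simp add: fun_eq_iff)
          then show ?thesis
            using has_derivative_mult_right[OF der[OF that, unfolded has_gradient_within_def], of \<mu>]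
            unfolding has_gradient_within_def by (simp only:)
        qed
        show "continuous_on H (\<lambda>x. \<mu> *\<^sub>R g x)" by (intro continuous_intros g)
        show "set_integrable lborel H (\<lambda>x. (norm (\<mu> *\<^sub>R g x))\<^sup>2)"
          unfolding norm_\<mu> by (intro set_integrable_mult_right int)
      qed (use int a_def m_def n J_eq pos in \<open>simp_all add: powr_\<mu>\<close>)
      then show "m * (\<mu> powr (1 + p) * (LINT x:H|lborel. \<bar>f x\<bar> powr (1 + p))) powr (1 - 1 / m) * J powr (1 / m)
        \<le> a * (\<mu> powr (2 * p) * (LINT x:H|lborel. \<bar>f x\<bar> powr (2 * p))
           + (1 - p)\<^sup>2 / 4 * (\<mu> powr 2 * (LINT x:H|lborel. (norm (g x))\<^sup>2)))"
        unfolding powr_\<mu> norm_\<mu> by simp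
    qed (use a in \<open>auto simp: set_lebesgue_integral_def intro!: integral_nonneg_AE\<close>)
  qed
  have eq: "GN_norms_finite p k f \<and> Lnorm (lebesgue_on H) (p + 1) f
      = C * Lnorm (lebesgue_on H) 2 (gradient_within H f) powr \<theta> * Lnorm (lebesgue_on H) (2 * p) f powr (1 - \<theta>)"
    if r: "0 < r" and t: "t $ k = 0" and f: "f = (\<lambda>x. c * extremal p (r *\<^sub>R (x - t)))" for c r t f
  proof -
    define g where "g x = (c * r) *\<^sub>R extremal_gradient p (r *\<^sub>R (x - t))" for x
    have der: "\<forall>x\<in>H. has_gradient_within f (g x) x H"
      unfolding f g_def by (intro ballI has_gradient_scaled_extremal p)
    have g: "continuous_on H g"
      unfolding g_def
      by (intro continuous_on_scaleR continuous_on_const continuous_on_compose2[OF continuous_on_extremal(2)[OF p, of UNIV]]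
          continuous_intros) auto
    note norms = half_space_Lnorms[where k = k, folded H_def, OF p(1) der g]
    have inv: "r *\<^sub>R (x - t) \<in> H \<longleftrightarrow> x \<in> H" for x
      using r t by (simp add: H_def half_space_def zero_le_mult_iff)
    have aff: "set_integrable lborel H (\<lambda>x. s * \<phi> (r *\<^sub>R (x - t)))"
        "(LINT x:H|lborel. s * \<phi> (r *\<^sub>R (x - t))) = s * (LINT x:H|lborel. \<phi> x) / r powr n"
      if "continuous_on H \<phi>" "set_integrable lborel H \<phi>" for s and \<phi> :: "real ^ 'n \<Rightarrow> real"
    proof -
      have "(\<lambda>x. indicator H x *\<^sub>R \<phi> x) \<in> borel_measurable borel"
        by (intro borel_measurable_continuous_on_indicator borel_closed H that(1))
      note A = set_integral_lborel_affine[OF this r inv]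
      show "set_integrable lborel H (\<lambda>x. s * \<phi> (r *\<^sub>R (x - t)))"
        using A(1) that(2) by (intro set_integrable_mult_right) simp
      have "r ^ DIM(real ^ 'n) = r powr n" using r n by (simp add: powr_realpow flip: n(2))
      then show "(LINT x:H|lborel. s * \<phi> (r *\<^sub>R (x - t))) = s * (LINT x:H|lborel. \<phi> x) / r powr n"
        using A(2) by simp
    qed
    note int = extremal_saturates_GN_functional(1-3)[OF H(1,3) p a_def]
    have cont: "continuous_on H (\<lambda>x. \<bar>extremal p x\<bar> powr (1 + p))" "continuous_on H (\<lambda>x. \<bar>extremal p x\<bar> powr (2 * p))"
      "continuous_on H (\<lambda>x. (norm (extremal_gradient p x))\<^sup>2)"
      using p by (auto intro!: continuous_on_powr' continuous_on_rabs continuous_on_const continuous_on_power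
          continuous_on_norm continuous_on_extremal)
    have powr_f: "\<bar>f x\<bar> powr q = \<bar>c\<bar> powr q * \<bar>extremal p (r *\<^sub>R (x - t))\<bar> powr q" for x q
      unfolding f by (simp add: abs_mult powr_mult)
    have norm_g: "(norm (g x))\<^sup>2 = (\<bar>c\<bar> * r) powr 2 * (norm (extremal_gradient p (r *\<^sub>R (x - t))))\<^sup>2" for x
      using r by (simp add: g_def power_mult_distrib)
    have fin: "GN_norms_finite p k f"
      unfolding norms(1) powr_f norm_g by (intro conjI aff(1) cont int)
    have N1: "Lnorm (lebesgue_on H) (p + 1) f = (\<bar>c\<bar> powr (p + 1) * J / r powr n) powr (1 / (p + 1))"
      unfolding norms(2) powr_f aff(2)[OF cont(1) int(2)] J_def by (simp add: add.commute)
    have N2: "Lnorm (lebesgue_on H) 2 (gradient_within H f) = ((\<bar>c\<bar> * r) powr 2 * Y\<^sub>0 / r powr n) powr (1 / 2)"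
      unfolding norms(3) norm_g aff(2)[OF cont(3) int(3)] Y\<^sub>0_def ..
    have N3: "Lnorm (lebesgue_on H) (2 * p) f = (\<bar>c\<bar> powr (2 * p) * X\<^sub>0 / r powr n) powr (1 / (2 * p))"
      unfolding norms(4) powr_f aff(2)[OF cont(2) int(1)] X\<^sub>0_def ..
    show ?thesis
    proof (cases "c = 0")
      case True
      then show ?thesis using fin unfolding N1 N2 N3 by simp
    next
      case False
      then show ?thesis
        using fin GN_quotient_scaling[OF p n(1) \<theta>n pos, of "\<bar>c\<bar>" r] r unfolding N1 N2 N3 C_def by simp
    qed
  qed
  show ?thesis
    using ineq eq unfolding H_def by blast
qed

end
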